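(* Let $\mu=\mathcal N(0,\mathcal C)$ be a centered Gaussian on $\mathbb R^{n_u}\times\mathbb R^{n_v}$ with strictly positive-definite covariance $\mathcal C=\begin{bmatrix}\mathcal C_{uu}&\mathcal C_{uv}\\ \mathcal C_{vu}&\mathcal C_{vv}\end{bmatrix}$ and marginals $\mu_u=\mathcal N(0,\mathcal C_{uu})$, $\mu_v=\mathcal N(0,\mathcal C_{vv})$. For $A\in\mathbb R^{n_u\times n_v}$ let $$\mathsf L_{\mathsf{joint}}(A)=-\mathbb E_{(u,v)\sim\mu}[\langle u,Av\rangle]+\log\mathbb E_{(u,v)\sim\mu_u\otimes\mu_v}\bigl[e^{\langle u,Av\rangle}\bigr].$$ Let $U\Sigma V^\top$ be the singular value decomposition of $\mathcal C_{uu}^{-1/2}\mathcal C_{uv}\mathcal C_{vv}^{-1/2}$, where $\Sigma$ is a diagonal matrix of size $\min(n_u,n_v)\times\min(n_u,n_v)$. The minimizer of $\mathsf L_{\mathsf{joint}}(A)$ over all matrices of size $n_u\times n_v$ is given by $$A^\ast=\mathcal C_{uu}^{-1/2}\,U h(\Sigma)V^\top\,\mathcal C_{vv}^{-1/2},$$ where the function $h$ defined in the context is applied elementwise to the diagonal entries of $\Sigma$. Furthermore, the minimizer of $\mathsf L_{\mathsf{joint}}(A)$ over the rank-constrained set of matrices $\mathcal A_r=\{A\in\mathbb R^{n_u\times n_v}:\operatorname{rank}(A)\le r\}$, for $0<r\le\min(n_u,n_v)$, is given by $$A^\ast(r)=\mathcal C_{uu}^{-1/2}\bigl(Uh(\Sigma)V^\top\bigr)_r\,\mathcal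 C_{vv}^{-1/2}.$$
   Context: $h(\sigma)=\sigma^{-1}\bigl(\tfrac12(1+4\sigma^2)^{1/2}-\tfrac12\bigr)$ for $\sigma\in(0,1]$, with $h(0)=0$ by continuity. For any matrix $M$, $M_r$ denotes the rank-$r$ truncation of its singular value decomposition. Square roots of positive-definite matrices are the symmetric positive-definite ones. *)

theory Defs
  imports "HOL-Analysis.Analysis"
begin

definition pos_def :: "real^'n^'n \<Rightarrow> bool" where
  "pos_def M \<longleftrightarrow> transpose M = M \<and> (\<forall>x. x \<noteq> 0 \<longrightarrow> x \<bullet> (M *v x) > 0)"

definition mat_sqrt :: "real^'n^'n \<Rightarrow> real^'n^'n" where
  "mat_sqrt M = (THE R. pos_def R \<and> R ** R = M)"

abbreviation mat_inv_sqrt :: "real^'n^'n \<Rightarrow> real^'n^'n" where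
  "mat_inv_sqrt M \<equiv> matrix_inv (mat_sqrt M)"

text \<open>A covariance matrix on the product space is indexed by the sum type; its blocks are
  indexed by the summands. The remaining off-diagonal block is the transpose of
  \<open>block_uv C\<close> whenever \<open>C\<close> is symmetric.\<close>

definition block_uu :: "real^('u::finite + 'v::finite)^('u + 'v) \<Rightarrow> real^'u^'u" where
  "block_uu C = (\<chi> i j. C $ Inl i $ Inl j)"

definition block_uv :: "real^('u::finite + 'v::finite)^('u + 'v) \<Rightarrow> real^'v^'u" where
  "block_uv C = (\<chi> i j. C $ Inl i $ Inr j)"

definition block_vv :: "real^('u::finite + 'v::finite)^('u + 'v) \<Rightarrow> real^'v^'v" where
  "block_vv C = (\<chi> i j. C $ Inr i $ Inr j)"

text \<open>The measure \<open>N(0, C)\<close>, for positive-definite \<open>C\<close>, through its Lebesgue density.\<close>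

definition gaussian :: "real^'n^'n \<Rightarrow> (real^'n) measure" where
  "gaussian C = density lborel
     (\<lambda>x. ennreal (exp (- (x \<bullet> (matrix_inv C *v x)) / 2) / sqrt ((2 * pi) ^ CARD('n) * det C)))"

text \<open>The same measure, transported along the identification of vectors indexed by a sum type
  with pairs of vectors.\<close>

definition joint_gaussian ::
  "real^('u::finite + 'v::finite)^('u + 'v) \<Rightarrow> ((real^'u) \<times> (real^'v)) measure" where
  "joint_gaussian C = distr (gaussian C) borel (\<lambda>w. (\<chi> i. w $ Inl i, \<chi> j. w $ Inr j))"

definition ext_log :: "ennreal \<Rightarrow> ereal" where
  "ext_log x = (if x = \<infinity> then \<infinity> else if x = 0 then -\<infinity> else ereal (ln (enn2real x)))"

text \<open>The second expectation is infinite for large \<open>A\<close>, so the loss takes values in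
  \<open>(-\<infinity>, \<infinity>]\<close>: a Bochner integral in that place would silently be \<open>0\<close>. The reference
  measure is the product of the two marginals of \<open>\<mu>\<close>.\<close>

definition L_joint ::
  "((real^'u) \<times> (real^'v)) measure \<Rightarrow> real^'v^'u \<Rightarrow> ereal" where
  "L_joint \<mu> A =
     - ereal (\<integral>(u, v). u \<bullet> (A *v v) \<partial>\<mu>)
     + ext_log (\<integral>\<^sup>+ (u, v). ennreal (exp (u \<bullet> (A *v v)))
                  \<partial>(distr \<mu> borel fst \<Otimes>\<^sub>M distr \<mu> borel snd))"

text \<open>Thin singular value decomposition. The index type \<open>'k\<close> of the singular values is any
  finite linearly ordered type of the right size, so that they can be required to be
  nonincreasing.\<close>

definition is_svd ::
  "real^'n^'m \<Rightarrow> real^('k::{finite,linorder})^'m \<Rightarrow> real^('k::_)^('k::_) \<Rightarrow> real^('k::_)^'n \<Rightarrow> bool" where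
  "is_svd M U S V \<longleftrightarrow>
     CARD('k) = min CARD('m) CARD('n) \<and>
     transpose U ** U = mat 1 \<and> transpose V ** V = mat 1 \<and>
     (\<forall>i j. i \<noteq> j \<longrightarrow> S $ i $ j = 0) \<and>
     (\<forall>i. 0 \<le> S $ i $ i) \<and>
     (\<forall>i j. i \<le> j \<longrightarrow> S $ j $ j \<le> S $ i $ i) \<and>
     M = U ** S ** transpose V"

text \<open>Keeps the first \<open>r\<close> diagonal entries.\<close>

definition diag_trunc ::
  "nat \<Rightarrow> real^('k::{finite,linorder})^('k::_) \<Rightarrow> real^('k::_)^('k::_)" where
  "diag_trunc r S = (\<chi> i j. if i = j \<and> card {l. l < i} < r then S $ i $ i else 0)"

text \<open>\<open>T\<close> is a truncation \<open>M\<^sub>r\<close>. It depends on the decomposition chosen when the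
  \<open>r\<close>-th and the next singular value of \<open>M\<close> are equal and positive, which is why this is a
  relation; otherwise it is unique. The type argument fixes the index type of
  the decomposition and has no other influence.\<close>

definition is_rank_truncation ::
  "'k::{finite,linorder} itself \<Rightarrow> nat \<Rightarrow> real^'n^'m \<Rightarrow> real^'n^'m \<Rightarrow> bool" where
  "is_rank_truncation _ r M T \<longleftrightarrow>
     (\<exists>(U :: real^('k::{finite,linorder})^'m) S (V :: real^('k::_)^'n).
        is_svd M U S V \<and> T = U ** diag_trunc r S ** transpose V)"

definition h :: "real \<Rightarrow> real" where
  "h \<sigma> = (if \<sigma> = 0 then 0 else inverse \<sigma> * (sqrt (1 + 4 * \<sigma>\<^sup>2) / 2 - 1 / 2))"

definition diag_map ::
  "(real \<Rightarrow> real) \<Rightarrow> real^('k::{finite,linorder})^('k::_) \<Rightarrow> real^('k::_)^('k::_)" where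
  "diag_map f S = (\<chi> i j. if i = j then f (S $ i $ i) else 0)"

end

theory Submission
  imports Defs "HOL-Probability.Probability"
begin

text \<open>
  Put \<open>B = Cuu\<^sup>1\<^sup>/\<^sup>2 A Cvv\<^sup>1\<^sup>/\<^sup>2\<close> and let \<open>M\<close> be the whitened cross-covariance, with singular values \<open>m\<^sub>j\<close> and
  singular vectors \<open>u\<^sub>j\<close>, \<open>v\<^sub>j\<close>. If \<open>B\<close> has singular values \<open>s\<^sub>i > 0\<close> and singular vectors \<open>x\<^sub>i\<close>, \<open>y\<^sub>i\<close>,
  the loss is \<open>\<Sum>\<^sub>i (\<phi>(s\<^sub>i) - s\<^sub>i \<langle>x\<^sub>i, M y\<^sub>i\<rangle>)\<close> with \<open>\<phi>(s) = - ln (1 - s\<^sup>2) / 2\<close> if all \<open>s\<^sub>i < 1\<close>, and infinite otherwise: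
  conditionally on \<open>u\<close> the exponential moment is a Gaussian moment generating function, and the
  remaining Gaussian integral factorizes over \<open>i\<close>.

  The function \<open>s \<mapsto> \<phi>(s) - s m\<close> has the unique minimizer \<open>h(m)\<close>, with a minimum \<open>g(m) \<le> 0\<close> that is
  decreasing in \<open>m\<close>. With the weights \<open>p\<^sub>i\<^sub>j = (\<langle>u\<^sub>j, x\<^sub>i\<rangle>\<^sup>2 + \<langle>v\<^sub>j, y\<^sub>i\<rangle>\<^sup>2) / 2\<close>, whose rows and columns sum to at
  most 1, the loss is at least \<open>\<Sum>\<^sub>i\<^sub>j p\<^sub>i\<^sub>j g(m\<^sub>j)\<close>, and hence at least the sum of the first \<open>r\<close> values \<open>g(m\<^sub>j)\<close>
  if \<open>B\<close> has rank at most \<open>r\<close>. In the case of equality the \<open>x\<^sub>i\<close> and \<open>y\<^sub>i\<close> have the same coordinates in the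
  bases \<open>u\<close> and \<open>v\<close>, and these are eigenvectors of \<open>h(\<Sigma>)\<close>. An eigenbasis extending them, sorted by
  eigenvalue, gives the decomposition of \<open>U h(\<Sigma>) V\<^sup>T\<close> of which \<open>B\<close> is the truncation. Conversely, every singular value
  decomposition of \<open>N = U h(\<Sigma>) V\<^sup>T\<close> comes from one of \<open>M\<close>, because \<open>M = N + M N\<^sup>T N\<close>.
\<close>

subsection \<open>Orthonormal families and symmetric matrices\<close>

text \<open>Indexed families, because left and right singular vectors are paired through a common
  index. A set of vectors is treated as the identity family on itself.\<close>

definition orthonormal_on :: "'i set \<Rightarrow> ('i \<Rightarrow> 'a::real_inner) \<Rightarrow> bool" where
  "orthonormal_on I x \<longleftrightarrow> (\<forall>i\<in>I. \<forall>j\<in>I. x i \<bullet> x j = (if i = j then 1 else 0))"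

lemma orthonormal_onD: "orthonormal_on I x \<Longrightarrow> i \<in> I \<Longrightarrow> j \<in> I \<Longrightarrow> x i \<bullet> x j = (if i = j then 1 else 0)"
  by (simp add: orthonormal_on_def)

lemma orthonormal_on_subset: "orthonormal_on I x \<Longrightarrow> J \<subseteq> I \<Longrightarrow> orthonormal_on J x"
  unfolding orthonormal_on_def by blast

lemma orthonormal_on_reindex:
  "orthonormal_on I x \<Longrightarrow> inj_on f J \<Longrightarrow> f ` J \<subseteq> I \<Longrightarrow> orthonormal_on J (\<lambda>j. x (f j))"
  by (auto simp: orthonormal_on_def image_subset_iff inj_on_eq_iff)

lemma orthonormal_on_inj: "orthonormal_on I x \<Longrightarrow> inj_on x I"
  by (rule inj_onI) (metis orthonormal_onD zero_neq_one)

lemma orthonormal_on_nonzero: "orthonormal_on I x \<Longrightarrow> i \<in> I \<Longrightarrow> x i \<noteq> 0"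
  by (metis inner_zero_left orthonormal_onD zero_neq_one)

lemma inner_sum_orthonormal:
  assumes "orthonormal_on I x" "finite I" "j \<in> I"
  shows "x j \<bullet> (\<Sum>i\<in>I. c i *\<^sub>R x i) = c j"
proof -
  have "x j \<bullet> (\<Sum>i\<in>I. c i *\<^sub>R x i) = (\<Sum>i\<in>I. if j = i then c i else 0)"
    unfolding inner_sum_right
    by (rule sum.cong) (auto simp: orthonormal_onD[OF assms(1,3)])
  then show ?thesis using assms by simp
qed

lemma norm_sum_orthonormal:
  assumes "orthonormal_on I x" "finite I"
  shows "(\<Sum>i\<in>I. c i *\<^sub>R x i) \<bullet> (\<Sum>i\<in>I. d i *\<^sub>R x i) = (\<Sum>i\<in>I. c i * d i)"
  unfolding inner_sum_left[of "\<lambda>i. c i *\<^sub>R x i"] inner_scaleR_left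
  by (rule sum.cong) (auto simp: inner_sum_orthonormal[OF assms])

text \<open>Pythagoras for the distance of \<open>z\<close> from its projection. Nonnegativity of
  the left side is Bessel's inequality, and its vanishing is the equality case used later for the
  singular vectors of a minimizer.\<close>

lemma orthonormal_residual:
  assumes "orthonormal_on I x" "finite I"
  shows "(z - (\<Sum>i\<in>I. (x i \<bullet> z) *\<^sub>R x i)) \<bullet> (z - (\<Sum>i\<in>I. (x i \<bullet> z) *\<^sub>R x i)) = z \<bullet> z - (\<Sum>i\<in>I. (x i \<bullet> z)\<^sup>2)"
proof -
  have "z \<bullet> (\<Sum>i\<in>I. (x i \<bullet> z) *\<^sub>R x i) = (\<Sum>i\<in>I. (x i \<bullet> z)\<^sup>2)"
    by (simp add: inner_sum_right power2_eq_square inner_commute)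
  then show ?thesis
    by (simp add: inner_diff_left inner_diff_right norm_sum_orthonormal[OF assms]
        inner_commute[of "sum _ _" z] power2_eq_square)
qed

lemma bessel:
  assumes "orthonormal_on I x" "finite I"
  shows "(\<Sum>i\<in>I. (x i \<bullet> z)\<^sup>2) \<le> z \<bullet> z"
  using orthonormal_residual[OF assms, of z]
    inner_ge_zero[of "z - (\<Sum>i\<in>I. (x i \<bullet> z) *\<^sub>R x i)"] by linarith

lemma bessel_eq:
  assumes "orthonormal_on I x" "finite I" "(\<Sum>i\<in>I. (x i \<bullet> z)\<^sup>2) = z \<bullet> z"
  shows "z = (\<Sum>i\<in>I. (x i \<bullet> z) *\<^sub>R x i)"
  using orthonormal_residual[OF assms(1,2), of z] assms(3) by simp

lemma orthonormal_on_independent: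
  fixes x :: "'i \<Rightarrow> 'a::euclidean_space"
  assumes "orthonormal_on I x"
  shows "independent (x ` I)"
proof (rule pairwise_orthogonal_independent)
  show "pairwise orthogonal (x ` I)"
    using assms by (auto simp: pairwise_def orthogonal_def orthonormal_on_def)
  show "0 \<notin> x ` I"
    using orthonormal_on_nonzero[OF assms] by (metis imageE)
qed

lemma orthonormal_on_dim:
  fixes x :: "'i \<Rightarrow> 'a::euclidean_space"
  assumes "orthonormal_on I x"
  shows "finite I" "dim (x ` I) = card I"
proof -
  note ind = orthonormal_on_independent[OF assms]
  have "finite (x ` I)"
    using ind by (rule finiteI_independent)
  then show "finite I"
    using finite_imageD orthonormal_on_inj[OF assms] by blast
  show "dim (x ` I) = card I"
    using dim_eq_card_independent[OF ind] card_image[OF orthonormal_on_inj[OF assms]] by simp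
qed

text \<open>Otherwise the residual of \<open>z\<close> would be a nonzero vector orthogonal to a
  spanning set.\<close>

lemma orthonormal_basis_expansion:
  fixes x :: "'i \<Rightarrow> 'a::euclidean_space"
  assumes "orthonormal_on I x" "card I = DIM('a)"
  shows "z = (\<Sum>i\<in>I. (x i \<bullet> z) *\<^sub>R x i)"
proof -
  note fin = orthonormal_on_dim(1)[OF assms(1)]
  have "span (x ` I) = UNIV"
    using orthonormal_on_dim(2)[OF assms(1)] assms(2) dim_eq_full by metis
  moreover have "\<exists>w. w \<noteq> 0 \<and> (\<forall>i\<in>I. w \<bullet> x i = 0)"
    if "z \<noteq> (\<Sum>i\<in>I. (x i \<bullet> z) *\<^sub>R x i)"
    using that inner_sum_orthonormal[OF assms(1) fin, of _ "\<lambda>i. x i \<bullet> z"]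
    by (intro exI[of _ "z - (\<Sum>i\<in>I. (x i \<bullet> z) *\<^sub>R x i)"])
       (auto simp: inner_diff_right inner_commute[of _ "x i" for i])
  moreover have "w = 0" if "\<forall>i\<in>I. w \<bullet> x i = 0" "span (x ` I) = UNIV" for w
  proof -
    have "orthogonal w w"
      by (rule orthogonal_to_span[of w "x ` I"]) (use that in \<open>auto simp: orthogonal_def\<close>)
    then show ?thesis by (simp add: orthogonal_def)
  qed
  ultimately show ?thesis by blast
qed

section \<open>Eigenbases of self-adjoint maps\<close>

text \<open>The first-order condition at the minimum \<open>t = 0\<close>: near 0 the linear term
  dominates the quadratic one.\<close>

lemma quadratic_nonneg_imp_linear_zero:
  fixes b c :: real
  assumes "\<And>t. 0 \<le> 2 * t * b + t\<^sup>2 * c"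
  shows "b = 0"
proof (rule ccontr)
  assume b: "b \<noteq> 0"
  \<comment> \<open>The minimizer of the quadratic after \<open>c\<close> is replaced by the larger,
    positive number \<open>\<bar>c\<bar> + 1\<close>.\<close>
  define t where "t = - b / (\<bar>c\<bar> + 1)"
  have "2 * t * b + t\<^sup>2 * c \<le> 2 * t * b + t\<^sup>2 * (\<bar>c\<bar> + 1)"
    by (intro add_left_mono mult_left_mono) auto
  also have "\<dots> = - b\<^sup>2 / (\<bar>c\<bar> + 1)"
  proof -
    have *: "2 * (- b / d) * b + (- b / d)\<^sup>2 * d = - b\<^sup>2 / d" if "d > 0" for d
      using that by (simp add: field_simps power2_eq_square)
    show ?thesis unfolding t_def by (rule *) simp
  qed
  also have "\<dots> < 0" using b by (simp add: divide_neg_pos)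
  finally show False using assms[of t] by simp
qed

text \<open>The new eigenvector maximises the Rayleigh quotient on the orthogonal complement of \<open>X\<close>.\<close>

lemma eigenvector_orthogonal_to:
  fixes f :: "'a::euclidean_space \<Rightarrow> 'a"
  assumes lin: "linear f" and adj: "\<And>x y. f x \<bullet> y = x \<bullet> f y"
    and X: "orthonormal_on X (\<lambda>x. x)" "\<And>b. b \<in> X \<Longrightarrow> f b = (b \<bullet> f b) *\<^sub>R b" "card X < DIM('a)"
  obtains v where "v \<bullet> v = 1" "\<And>b. b \<in> X \<Longrightarrow> b \<bullet> v = 0" "f v = (v \<bullet> f v) *\<^sub>R v"
proof -
  define W where "W = {x. \<forall>b\<in>X. b \<bullet> x = 0}"
  have sub: "subspace W"
    by (auto simp: W_def subspace_def inner_add_right)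
  have inv: "f x \<in> W" if "x \<in> W" for x
  proof -
    have "b \<bullet> f x = 0" if "b \<in> X" for b
    proof -
      have "b \<bullet> f x = f b \<bullet> x" by (simp add: adj)
      also have "\<dots> = (b \<bullet> f b) * (b \<bullet> x)"
        by (subst X(2)[OF that]) simp
      also have "b \<bullet> x = 0" using \<open>x \<in> W\<close> that by (simp add: W_def)
      finally show ?thesis by simp
    qed
    then show ?thesis by (simp add: W_def)
  qed
  have "dim X < DIM('a)"
    using orthonormal_on_dim(2)[OF X(1)] X(3) by simp
  then obtain a where a: "a \<noteq> 0" "\<And>y. y \<in> span X \<Longrightarrow> orthogonal a y"
    using orthogonal_to_subspace_exists by blast
  have aW: "a \<in> W"
    using a(2) by (auto simp: W_def orthogonal_def inner_commute span_base)
  define K where "K = sphere 0 1 \<inter> W"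
  have "compact K"
    unfolding K_def using closed_subspace[OF sub] by (intro compact_Int_closed) auto
  moreover have "(1 / norm a) *\<^sub>R a \<in> K"
    using aW a(1) by (auto simp: K_def intro: subspace_scale[OF sub])
  moreover have "continuous_on K (\<lambda>x. x \<bullet> f x)"
    by (intro continuous_intros linear_continuous_on linear_conv_bounded_linear[THEN iffD1] lin)
  ultimately obtain v where v: "v \<in> K" and max: "\<And>y. y \<in> K \<Longrightarrow> y \<bullet> f y \<le> v \<bullet> f v"
    using continuous_attains_sup[of K "\<lambda>x. x \<bullet> f x"] by blast
  define l where "l = v \<bullet> f v"
  have vv: "v \<bullet> v = 1" and vW: "v \<in> W"
    using v by (auto simp: K_def norm_eq_1)
  \<comment> \<open>On \<open>W\<close> this quadratic form is nonnegative and it vanishes at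
    \<open>v\<close>, so its first variation at \<open>v\<close> in directions of \<open>W\<close>
    is zero.\<close>
  define q where "q x = l * (x \<bullet> x) - x \<bullet> f x" for x
  have q: "0 \<le> q x" if "x \<in> W" for x
  proof (cases "x = 0")
    case True
    then show ?thesis by (simp add: q_def linear_0[OF lin])
  next
    case False
    have "(1 / norm x) *\<^sub>R x \<in> K"
      using that False by (auto simp: K_def intro: subspace_scale[OF sub])
    from max[OF this] have "(x \<bullet> f x) / (norm x)\<^sup>2 \<le> l"
      by (simp add: l_def linear_scale[OF lin] power2_eq_square)
    then have "x \<bullet> f x \<le> l * (norm x)\<^sup>2"
      using False by (simp add: pos_divide_le_eq)
    then show ?thesis by (simp add: q_def power2_norm_eq_inner)
  qed
  have orth: "(l *\<^sub>R v - f v) \<bullet> w = 0" if w: "w \<in> W" for w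
  proof (rule quadratic_nonneg_imp_linear_zero)
    fix t :: real
    have "v + t *\<^sub>R w \<in> W"
      using vW w by (intro subspace_add subspace_scale sub)
    then have "0 \<le> q (v + t *\<^sub>R w)" by (rule q)
    also have "q (v + t *\<^sub>R w) = q v + 2 * t * ((l *\<^sub>R v - f v) \<bullet> w) + t\<^sup>2 * q w"
      using adj[of v w]
      by (simp add: q_def linear_add[OF lin] linear_scale[OF lin] inner_add_left inner_add_right
          inner_diff_left inner_commute[of w v] inner_commute[of w "f v"] power2_eq_square algebra_simps)
    also have "q v = 0" by (simp add: q_def l_def vv)
    finally show "0 \<le> 2 * t * ((l *\<^sub>R v - f v) \<bullet> w) + t\<^sup>2 * q w" by simp
  qed
  \<comment> \<open>The gradient of \<open>q\<close> at \<open>v\<close> is orthogonal to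
    \<open>W\<close> and lies in \<open>W\<close> itself, hence is zero.\<close>
  have "l *\<^sub>R v - f v \<in> W"
    using vW inv by (intro subspace_diff subspace_scale sub) auto
  from orth[OF this] have "f v = l *\<^sub>R v" by simp
  then show ?thesis
    using that[of v] vv vW by (auto simp: W_def l_def)
qed

text \<open>Induction on the number of missing vectors. Starting from a prescribed \<open>X\<close>
  allows the singular vectors of a minimizer to be kept in the basis; for \<open>f = 0\<close> the
  lemma is plain orthonormal completion.\<close>

lemma eigenbasis_extension:
  fixes f :: "'a::euclidean_space \<Rightarrow> 'a"
  assumes lin: "linear f" and adj: "\<And>x y. f x \<bullet> y = x \<bullet> f y"
    and "orthonormal_on X (\<lambda>x. x)" "\<And>b. b \<in> X \<Longrightarrow> f b = (b \<bullet> f b) *\<^sub>R b"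
  shows "\<exists>B. X \<subseteq> B \<and> orthonormal_on B (\<lambda>x. x) \<and> (\<forall>b\<in>B. f b = (b \<bullet> f b) *\<^sub>R b) \<and> card B = DIM('a)"
  using assms(3,4)
proof (induction "DIM('a) - card X" arbitrary: X rule: less_induct)
  case less
  note X = less.prems
  have fin: "finite X" by (rule orthonormal_on_dim(1)[OF X(1)])
  have le: "card X \<le> DIM('a)"
    using orthonormal_on_dim(2)[OF X(1)] dim_subset_UNIV[of X] by simp
  show ?case
  proof (cases "card X = DIM('a)")
    case True
    then show ?thesis using X by blast
  next
    case False
    then have lt: "card X < DIM('a)" using le by simp
    obtain v where v: "v \<bullet> v = 1" "\<And>b. b \<in> X \<Longrightarrow> b \<bullet> v = 0" "f v = (v \<bullet> f v) *\<^sub>R v"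
      using eigenvector_orthogonal_to[OF lin adj X lt] by blast
    have "v \<notin> X" using v(1,2) by force
    have "orthonormal_on (insert v X) (\<lambda>x. x)"
      using X(1) v(1,2) by (auto simp: orthonormal_on_def inner_commute)
    moreover have "card (insert v X) = Suc (card X)"
      using \<open>v \<notin> X\<close> fin by simp
    ultimately obtain B where "insert v X \<subseteq> B" "orthonormal_on B (\<lambda>x. x)"
        "\<forall>b\<in>B. f b = (b \<bullet> f b) *\<^sub>R b" "card B = DIM('a)"
      using less.hyps[of "insert v X"] lt X(2) v(3) by (metis diff_less_mono2 insert_iff lessI)
    then show ?thesis by blast
  qed
qed

section \<open>Positive-definite matrices and their square roots\<close>

lemma pos_def_symD: "pos_def M \<Longrightarrow> transpose M = M"
  by (simp add: pos_def_def)

lemma pos_defD: "pos_def M \<Longrightarrow> x \<noteq> 0 \<Longrightarrow> 0 < x \<bullet> (M *v x)"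
  by (simp add: pos_def_def)

lemma symmetric_inner: "transpose M = M \<Longrightarrow> (M *v x) \<bullet> y = x \<bullet> (M *v (y::real^'n))"
  by (metis dot_lmul_matrix inner_commute vector_transpose_matrix)

lemma pos_def_invertible:
  assumes "pos_def (M::real^'n^'n)" shows "invertible M"
proof -
  have "M *v x = 0 \<Longrightarrow> x = 0" for x
    using pos_defD[OF assms, of x] by auto
  then show ?thesis
    unfolding invertible_left_inverse matrix_left_invertible_ker by blast
qed

lemma symmetric_eigenbasis:
  fixes M :: "real^'n^'n"
  assumes "transpose M = M"
  obtains B where "orthonormal_on B (\<lambda>x. x)" "\<And>b. b \<in> B \<Longrightarrow> M *v b = (b \<bullet> (M *v b)) *\<^sub>R b"
    "card B = CARD('n)" "finite B"
proof -
  have "\<exists>B. {} \<subseteq> B \<and> orthonormal_on B (\<lambda>x. x) \<and> (\<forall>b\<in>B. M *v b = (b \<bullet> (M *v b)) *\<^sub>R b) \<and> card B = DIM(real^'n)"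
    by (rule eigenbasis_extension) (auto simp: symmetric_inner[OF assms] orthonormal_on_def)
  then show ?thesis using that orthonormal_on_dim(1) by auto
qed

text \<open>In an orthonormal eigenbasis of \<open>M\<close> the map \<open>f\<close> multiplies
  each coordinate by the square root of the eigenvalue.\<close>

lemma ex_pos_def_sqrt:
  fixes M :: "real^'n^'n"
  assumes M: "pos_def M"
  shows "\<exists>R. pos_def R \<and> R ** R = M"
proof -
  obtain B where B: "orthonormal_on B (\<lambda>x. x)" "\<And>b. b \<in> B \<Longrightarrow> M *v b = (b \<bullet> (M *v b)) *\<^sub>R b"
      "card B = CARD('n)" "finite B"
    using symmetric_eigenbasis[OF pos_def_symD[OF M]] by blast
  have expand: "z = (\<Sum>b\<in>B. (b \<bullet> z) *\<^sub>R b)" for z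
    using orthonormal_basis_expansion[OF B(1)] B(3) by simp
  define l where "l b = sqrt (b \<bullet> (M *v b))" for b
  have lpos: "0 < l b" if "b \<in> B" for b
    using pos_defD[OF M, of b] orthonormal_on_nonzero[OF B(1) that] by (simp add: l_def)
  define f where "f z = (\<Sum>b\<in>B. (l b * (b \<bullet> z)) *\<^sub>R b)" for z
  have lin: "linear f"
    by (rule linearI)
       (auto simp: f_def inner_add_right algebra_simps sum.distrib scaleR_sum_right)
  define R where "R = matrix f"
  have R: "R *v z = f z" for z
    by (simp add: R_def matrix_works lin)
  have fin: "b \<bullet> f z = l b * (b \<bullet> z)" if "b \<in> B" for b z
    unfolding f_def by (rule inner_sum_orthonormal[OF B(1,4) that])
  have adj: "f x \<bullet> y = x \<bullet> f y" for x y
    by (simp add: f_def inner_sum_left inner_sum_right ac_simps inner_commute)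
  have "transpose R = R"
    unfolding R_def using lin adj by (metis adjoint_unique matrix_adjoint)
  moreover have "0 < x \<bullet> (R *v x)" if "x \<noteq> 0" for x
  proof -
    have "x \<bullet> (R *v x) = (\<Sum>b\<in>B. l b * (b \<bullet> x)\<^sup>2)"
      by (simp add: R f_def inner_sum_right power2_eq_square ac_simps inner_commute)
    moreover have "\<exists>b\<in>B. b \<bullet> x \<noteq> 0"
      using expand[of x] that by (metis (no_types, lifting) scale_eq_0_iff sum.neutral)
    ultimately show ?thesis
      using lpos B(4) by (auto intro!: sum_pos2 simp: less_imp_le)
  qed
  moreover have "R ** R = M"
  proof -
    have "(R ** R) *v z = M *v z" for z
    proof -
      have "(R ** R) *v z = (\<Sum>b\<in>B. (l b * (l b * (b \<bullet> z))) *\<^sub>R b)"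
        by (simp add: R f_def[of "f z"] fin flip: matrix_vector_mul_assoc)
      also have "\<dots> = (\<Sum>b\<in>B. (b \<bullet> z) *\<^sub>R (M *v b))"
      proof (rule sum.cong)
        fix b assume b: "b \<in> B"
        have "l b * l b = b \<bullet> (M *v b)"
          using lpos[OF b] by (simp add: l_def)
        then have "M *v b = (l b * l b) *\<^sub>R b"
          using B(2)[OF b] by simp
        then show "(l b * (l b * (b \<bullet> z))) *\<^sub>R b = (b \<bullet> z) *\<^sub>R (M *v b)"
          by (simp add: ac_simps)
      qed simp
      also have "\<dots> = M *v (\<Sum>b\<in>B. (b \<bullet> z) *\<^sub>R b)"
        by (simp add: linear_sum[OF matrix_vector_mul_linear] matrix_vector_mult_scaleR)
      finally show ?thesis using expand[of z] by simp
    qed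
    then show ?thesis by (simp add: matrix_eq)
  qed
  ultimately show ?thesis by (auto simp: pos_def_def)
qed

text \<open>An eigenvector \<open>b\<close> of \<open>R\<close> with eigenvalue \<open>l > 0\<close> satisfies
  \<open>(R' + l) ((R' - l) b) = 0\<close>, and \<open>R' + l\<close> is injective.\<close>

lemma pos_def_sqrt_unique:
  fixes R R' :: "real^'n^'n"
  assumes R: "pos_def R" and R': "pos_def R'" and eq: "R ** R = R' ** R'"
  shows "R = R'"
proof -
  obtain B where B: "orthonormal_on B (\<lambda>x. x)" "\<And>b. b \<in> B \<Longrightarrow> R *v b = (b \<bullet> (R *v b)) *\<^sub>R b"
      "card B = CARD('n)" "finite B"
    using symmetric_eigenbasis[OF pos_def_symD[OF R]] by blast
  have expand: "z = (\<Sum>b\<in>B. (b \<bullet> z) *\<^sub>R b)" for z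
    using orthonormal_basis_expansion[OF B(1)] B(3) by simp
  have same: "R' *v b = R *v b" if b: "b \<in> B" for b
  proof -
    define l where "l = b \<bullet> (R *v b)"
    have l: "0 < l" "R *v b = l *\<^sub>R b"
      using pos_defD[OF R, of b] orthonormal_on_nonzero[OF B(1) b] B(2)[OF b] by (auto simp: l_def)
    define w where "w = R' *v b - l *\<^sub>R b"
    have "R' *v (R' *v b) = R *v (R *v b)"
      by (simp add: matrix_vector_mul_assoc eq)
    also have "\<dots> = l *\<^sub>R (l *\<^sub>R b)"
      by (simp add: l(2) matrix_vector_mult_scaleR)
    finally have "R' *v w = - l *\<^sub>R w"
      by (simp add: w_def matrix_vector_mult_diff_distrib matrix_vector_mult_scaleR algebra_simps)
    then have "w \<bullet> (R' *v w) \<le> 0" using l(1) by simp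
    then have "w = 0" using pos_defD[OF R', of w] by fastforce
    then show ?thesis by (simp add: w_def l(2))
  qed
  have "R *v z = R' *v z" for z
    by (subst (1 2) expand[of z])
       (simp add: linear_sum[OF matrix_vector_mul_linear] matrix_vector_mult_scaleR same)
  then show ?thesis by (simp add: matrix_eq)
qed

lemma mat_sqrt:
  assumes "pos_def M"
  shows "pos_def (mat_sqrt M)" "mat_sqrt M ** mat_sqrt M = M"
proof -
  have "\<exists>!R. pos_def R \<and> R ** R = M"
    using ex_pos_def_sqrt[OF assms] pos_def_sqrt_unique by metis
  from theI'[OF this] show "pos_def (mat_sqrt M)" "mat_sqrt M ** mat_sqrt M = M"
    by (auto simp: mat_sqrt_def)
qed

lemma pos_def_matrix_inv:
  assumes M: "pos_def (M::real^'n^'n)"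
  shows "transpose (matrix_inv M) = matrix_inv M" "matrix_inv M ** M = mat 1" "M ** matrix_inv M = mat 1"
proof -
  note inv = pos_def_invertible[OF M]
  show 1: "matrix_inv M ** M = mat 1" "M ** matrix_inv M = mat 1"
    using someI_ex[OF inv[unfolded invertible_def]] by (auto simp: matrix_inv_def)
  have "transpose (matrix_inv M) ** M = mat 1"
    by (metis 1(2) M matrix_transpose_mul pos_def_symD transpose_mat)
  then show "transpose (matrix_inv M) = matrix_inv M"
    by (metis 1(2) matrix_mul_assoc matrix_mul_lid matrix_mul_rid)
qed

section \<open>Matrices as sums of dyads\<close>

text \<open>The matrix \<open>\<Sum>i\<in>I. s i x i y i^T\<close>. With a free index set, full
  decompositions, truncations and matrices of low rank all have this one form.\<close>

definition dyadic_sum :: "'i set \<Rightarrow> ('i \<Rightarrow> real) \<Rightarrow> ('i \<Rightarrow> real^'m) \<Rightarrow> ('i \<Rightarrow> real^'n) \<Rightarrow> real^'n^'m" where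
  "dyadic_sum I s x y = (\<chi> a b. \<Sum>i\<in>I. s i * x i $ a * y i $ b)"

lemma dyadic_sum_mult: "dyadic_sum I s x y *v z = (\<Sum>i\<in>I. (s i * (y i \<bullet> z)) *\<^sub>R x i)"
proof -
  have "(\<Sum>b\<in>UNIV. (\<Sum>i\<in>I. s i * x i $ a * y i $ b) * z $ b) = (\<Sum>i\<in>I. s i * (y i \<bullet> z) * x i $ a)" for a
  proof -
    have "(\<Sum>b\<in>UNIV. (\<Sum>i\<in>I. s i * x i $ a * y i $ b) * z $ b)
        = (\<Sum>b\<in>UNIV. \<Sum>i\<in>I. s i * x i $ a * y i $ b * z $ b)"
      by (simp add: sum_distrib_right)
    also have "\<dots> = (\<Sum>i\<in>I. \<Sum>b\<in>UNIV. s i * x i $ a * y i $ b * z $ b)"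
      by (rule sum.swap)
    finally show ?thesis
      by (simp add: inner_vec_def sum_distrib_left sum_distrib_right ac_simps)
  qed
  then show ?thesis
    by (simp add: dyadic_sum_def matrix_vector_mult_def vec_eq_iff)
qed

lemma rank_dyadic_sum:
  assumes "finite I" shows "rank (dyadic_sum I s x y) \<le> card I"
proof -
  have "range ((*v) (dyadic_sum I s x y)) \<subseteq> span (x ` I)"
    unfolding dyadic_sum_mult by (auto intro!: span_sum intro: span_scale span_base)
  then have "rank (dyadic_sum I s x y) \<le> dim (span (x ` I))"
    unfolding rank_dim_range by (rule dim_subset)
  also have "\<dots> \<le> card (x ` I)"
    using dim_le_card[of "span (x ` I)" "x ` I"] assms by simp
  also have "\<dots> \<le> card I" using assms by (rule card_image_le)
  finally show ?thesis .
qed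

text \<open>An orthonormal eigenbasis of \<open>transpose B ** B\<close> is mapped by
  \<open>B\<close> to orthogonal vectors; those mapped to 0 are dropped. The remaining right
  singular vectors serve as their own indices, and there are at most \<open>rank B\<close> of them
  because the left ones are orthonormal in the range of \<open>B\<close>.\<close>

lemma ex_svd:
  fixes B :: "real^'n^'m"
  obtains E :: "(real^'n) set" and s x where "finite E" "card E \<le> rank B"
    "orthonormal_on E x" "orthonormal_on E (\<lambda>e. e)" "\<And>e. e \<in> E \<Longrightarrow> 0 < s e"
    "B = dyadic_sum E s x (\<lambda>e. e)"
proof -
  have sym: "transpose (transpose B ** B) = transpose B ** B"
    by (simp add: matrix_transpose_mul)
  obtain D where D: "orthonormal_on D (\<lambda>x. x)"
      "\<And>b. b \<in> D \<Longrightarrow> (transpose B ** B) *v b = (b \<bullet> ((transpose B ** B) *v b)) *\<^sub>R b"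
      "card D = CARD('n)" "finite D"
    using symmetric_eigenbasis[OF sym] by blast
  have expand: "z = (\<Sum>b\<in>D. (b \<bullet> z) *\<^sub>R b)" for z
    using orthonormal_basis_expansion[OF D(1)] D(3) by simp
  have gram: "(B *v a) \<bullet> (B *v b) = a \<bullet> ((transpose B ** B) *v b)" for a b
    by (metis dot_lmul_matrix matrix_vector_mul_assoc transpose_matrix_vector inner_commute)
  define s where "s b = norm (B *v b)" for b
  define x where "x b = (1 / s b) *\<^sub>R (B *v b)" for b
  define E where "E = {b\<in>D. B *v b \<noteq> 0}"
  have fin: "finite E" using D(4) by (simp add: E_def)
  have pos: "0 < s e" if "e \<in> E" for e using that by (simp add: E_def s_def)
  have ex: "orthonormal_on E x"
    unfolding orthonormal_on_def
  proof (intro ballI)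
    fix i j assume ij: "i \<in> E" "j \<in> E"
    show "x i \<bullet> x j = (if i = j then 1 else 0)"
    proof (cases "i = j")
      case True
      then show ?thesis using pos[OF ij(1)]
        by (simp add: x_def s_def dot_square_norm power2_eq_square)
    next
      case False
      have "(B *v i) \<bullet> (B *v j) = (j \<bullet> ((transpose B ** B) *v j)) * (i \<bullet> j)"
        unfolding gram using D(2)[of j] ij by (metis (no_types, lifting) E_def inner_scaleR_right mem_Collect_eq)
      also have "i \<bullet> j = 0" using D(1) ij False by (auto simp: E_def orthonormal_on_def)
      finally show ?thesis using False by (simp add: x_def)
    qed
  qed
  have "B *v z = dyadic_sum E s x (\<lambda>e. e) *v z" for z
  proof -
    have "B *v z = (\<Sum>b\<in>D. (b \<bullet> z) *\<^sub>R (B *v b))"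
      by (subst expand[of z])
         (simp add: linear_sum[OF matrix_vector_mul_linear] matrix_vector_mult_scaleR)
    also have "\<dots> = (\<Sum>b\<in>E. (b \<bullet> z) *\<^sub>R (B *v b))"
      by (rule sum.mono_neutral_right) (auto simp: E_def D(4))
    also have "\<dots> = dyadic_sum E s x (\<lambda>e. e) *v z"
      unfolding dyadic_sum_mult by (intro sum.cong) (auto simp: x_def dest: pos)
    finally show ?thesis .
  qed
  then have B: "B = dyadic_sum E s x (\<lambda>e. e)" by (simp add: matrix_eq)
  have "x ` E \<subseteq> range ((*v) B)"
    by (auto simp: x_def matrix_vector_mult_scaleR[symmetric])
  then have "dim (x ` E) \<le> rank B"
    unfolding rank_dim_range by (rule dim_subset)
  then have "card E \<le> rank B"
    by (simp add: orthonormal_on_dim(2)[OF ex])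
  moreover have "orthonormal_on E (\<lambda>e. e)"
    using D(1) by (rule orthonormal_on_subset) (auto simp: E_def)
  ultimately show ?thesis using that fin ex pos B by blast
qed

subsection \<open>Gaussian integrals\<close>

lemma borel_measurable_matrix_vector_mult [measurable]:
  "(*v) (X :: real^'n^'m) \<in> borel_measurable borel"
  by (intro borel_measurable_continuous_onI linear_continuous_on linear_conv_bounded_linear[THEN iffD1]
      matrix_vector_mul_linear)

text \<open>The family is completed to an orthonormal basis, which forms the columns of
  \<open>W\<close>; \<open>p i\<close> is the column that holds \<open>x i\<close>.\<close>

lemma orthonormal_on_basis_index:
  fixes x :: "'i \<Rightarrow> real^'n"
  assumes x: "orthonormal_on I x"
  obtains W :: "real^'n^'n" and p where "orthogonal_matrix W" "inj_on p I"
    "\<And>i. i \<in> I \<Longrightarrow> transpose W *v x i = axis (p i) 1"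
proof -
  have "orthonormal_on (x ` I) (\<lambda>x. x)"
    using x orthonormal_on_inj[OF x] by (auto simp: orthonormal_on_def inj_on_eq_iff)
  then have "\<exists>B. x ` I \<subseteq> B \<and> orthonormal_on B (\<lambda>x. x) \<and>
      (\<forall>b\<in>B. (0::real^'n) = (b \<bullet> 0) *\<^sub>R b) \<and> card B = DIM(real^'n)"
    by (intro eigenbasis_extension) (auto simp: linear_iff)
  then obtain B where B: "x ` I \<subseteq> B" "orthonormal_on B (\<lambda>x. x)" "card B = CARD('n)"
    by auto
  have "finite B" by (rule orthonormal_on_dim(1)[OF B(2)])
  then obtain b where b: "bij_betw b (UNIV::'n set) B"
    using B(3) by (metis finite finite_same_card_bij)
  have bo: "orthonormal_on UNIV b"
    using orthonormal_on_reindex[OF B(2), of b UNIV] b by (auto simp: bij_betw_def)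
  define W :: "real^'n^'n" where "W = (\<chi> i j. b j $ i)"
  have W: "(transpose W *v z) $ j = b j \<bullet> z" for z j
    by (simp add: W_def transpose_def matrix_vector_mult_def inner_vec_def)
  have "transpose W ** W = mat 1"
    using bo
    by (simp add: W_def matrix_matrix_mult_def transpose_def mat_def vec_eq_iff orthonormal_on_def inner_vec_def)
  then have ort: "orthogonal_matrix W"
    by (simp add: orthogonal_matrix)
  define p where "p i = inv_into UNIV b (x i)" for i
  have bp: "b (p i) = x i" if "i \<in> I" for i
    unfolding p_def using that B(1) b by (intro f_inv_into_f) (auto simp: bij_betw_def)
  have "inj_on p I"
    using bp orthonormal_on_inj[OF x] by (metis inj_on_def)
  moreover have "transpose W *v x i = axis (p i) 1" if "i \<in> I" for i
    using bo that by (auto simp: vec_eq_iff W axis_def orthonormal_on_def simp del: transpose_matrix_vector simp flip: bp)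
  ultimately show ?thesis using that ort by blast
qed

text \<open>As in the proof that Haar measure is unique, a double integral is evaluated in two ways, with
  Tonelli's theorem and translation invariance. The change of variables theorem of the library
  does not apply, since it requires a well-ordered index type.\<close>

lemma nn_integral_lborel_orthogonal:
  fixes W :: "real^'n^'n"
  assumes W: "orthogonal_matrix W" and g[measurable]: "g \<in> borel_measurable borel"
  shows "(\<integral>\<^sup>+y. g (W *v y) \<partial>lborel) = (\<integral>\<^sup>+x. g x \<partial>lborel)"
proof -
  have WT: "transpose W ** W = mat 1" "W ** transpose W = mat 1"
    using W by (auto simp: orthogonal_matrix_def)
  have shift: "(\<integral>\<^sup>+y. u (c + y) \<partial>lborel) = (\<integral>\<^sup>+y. u y \<partial>lborel)"
    if [measurable]: "u \<in> borel_measurable borel" for u :: "real^'n \<Rightarrow> ennreal" and c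
  proof -
    have "(\<integral>\<^sup>+y. u y \<partial>lborel) = (\<integral>\<^sup>+y. u y \<partial>distr lborel borel ((+) c))"
      by (simp add: lborel_distr_plus)
    then show ?thesis by (simp add: nn_integral_distr)
  qed
  have Wshift: "(\<integral>\<^sup>+y. u (x + W *v y) \<partial>lborel) = (\<integral>\<^sup>+y. u (W *v y) \<partial>lborel)"
    if [measurable]: "u \<in> borel_measurable borel" for u :: "real^'n \<Rightarrow> ennreal" and x
  proof -
    have "W *v (transpose W *v x + y) = x + W *v y" for y
      by (simp add: matrix_vector_right_distrib matrix_vector_mul_assoc WT del: transpose_matrix_vector)
    then show ?thesis
      using shift[of "\<lambda>y. u (W *v y)" "transpose W *v x"] by simp
  qed
  \<comment> \<open>A test function that is even, invariant under \<open>W\<close>, and has a finite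
    nonzero integral, so that the integral can be cancelled at the end.\<close>
  define f where "f = (indicator (ball 0 1) :: real^'n \<Rightarrow> ennreal)"
  have [measurable]: "f \<in> borel_measurable borel" by (simp add: f_def borel_measurable_indicator)
  have nW: "norm (W *v y) = norm y" for y
  proof -
    have "(W *v y) \<bullet> (W *v y) = y \<bullet> ((transpose W ** W) *v y)"
      by (metis dot_lmul_matrix matrix_vector_mul_assoc transpose_matrix_vector inner_commute)
    then show ?thesis by (simp add: WT norm_eq_sqrt_inner)
  qed
  have fW: "f (- (W *v y)) = f y" for y
    by (auto simp: f_def indicator_def nW)
  define A where "A = (\<integral>\<^sup>+x. f x \<partial>lborel)"
  have A: "A \<noteq> 0" "A \<noteq> \<infinity>"
    using emeasure_lborel_ball_finite[of "0::real^'n" 1] content_ball_pos[of 1 "0::real^'n"]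
    by (auto simp: A_def f_def measure_def)
  have "A * (\<integral>\<^sup>+y. g (W *v y) \<partial>lborel) = (\<integral>\<^sup>+x. \<integral>\<^sup>+y. f x * g (x + W *v y) \<partial>lborel \<partial>lborel)"
    by (simp add: A_def nn_integral_cmult nn_integral_multc Wshift)
  also have "\<dots> = (\<integral>\<^sup>+y. \<integral>\<^sup>+x. f x * g (x + W *v y) \<partial>lborel \<partial>lborel)"
    by (rule lborel_pair.Fubini') measurable
  \<comment> \<open>Translating \<open>x\<close> by \<open>W *v y\<close> moves the dependence on
    \<open>y\<close> from \<open>g\<close> to \<open>f\<close>. By the symmetries of
    \<open>f\<close> the integral over \<open>y\<close> is then the constant \<open>A\<close>,
    whatever \<open>x\<close> is.\<close>
  also have "\<dots> = (\<integral>\<^sup>+y. \<integral>\<^sup>+x. f (x - W *v y) * g x \<partial>lborel \<partial>lborel)"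
  proof (rule nn_integral_cong)
    fix y
    show "(\<integral>\<^sup>+x. f x * g (x + W *v y) \<partial>lborel) = (\<integral>\<^sup>+x. f (x - W *v y) * g x \<partial>lborel)"
      using shift[of "\<lambda>x. f (x - W *v y) * g x" "W *v y"] by (simp add: add.commute)
  qed
  also have "\<dots> = (\<integral>\<^sup>+x. \<integral>\<^sup>+y. f (x - W *v y) * g x \<partial>lborel \<partial>lborel)"
    by (rule lborel_pair.Fubini') measurable
  also have "\<dots> = A * (\<integral>\<^sup>+x. g x \<partial>lborel)"
  proof -
    have "(\<integral>\<^sup>+y. f (x - W *v y) \<partial>lborel) = A" for x
      using Wshift[of "\<lambda>z. f (- z)" "- x"] by (simp add: fW A_def)
    then show ?thesis by (simp add: nn_integral_multc nn_integral_cmult)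
  qed
  finally show ?thesis using A by (simp add: ennreal_mult_cancel_left)
qed

lemma nn_integral_lborel_diagonal:
  fixes f :: "real^'n \<Rightarrow> ennreal"
  assumes d: "\<And>i. d i \<noteq> 0" and f[measurable]: "f \<in> borel_measurable borel"
  shows "(\<integral>\<^sup>+x. f x \<partial>lborel) = (\<integral>\<^sup>+z. ennreal \<bar>\<Prod>i\<in>UNIV. d i\<bar> * f (\<chi> i. d i * z $ i) \<partial>lborel)"
proof -
  \<comment> \<open>\<open>lborel_affine_euclidean\<close> takes the scaling factors as a function
    of the basis vectors; \<open>c\<close> reads off the coordinate from such a vector.\<close>
  define c where "c b = d (THE i. b = axis i (1::real))" for b :: "real^'n"
  have c: "c (axis i 1) = d i" for i
    by (simp add: c_def axis_eq_axis)
  have B: "(Basis :: (real^'n) set) = (\<lambda>i. axis i 1) ` UNIV"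
    by (auto simp: Basis_vec_def)
  have inj: "inj (\<lambda>i::'n. axis i (1::real))"
    by (auto simp: inj_def axis_eq_axis)
  have T: "0 + (\<Sum>j\<in>Basis. (c j * (x \<bullet> j)) *\<^sub>R j) = (\<chi> i. d i * x $ i)" for x
  proof -
    have "(\<Sum>j\<in>Basis. (c j * (x \<bullet> j)) *\<^sub>R j) = (\<Sum>i\<in>UNIV. (d i * x $ i) *\<^sub>R axis i 1)"
      unfolding B sum.reindex[OF inj] by (simp add: c inner_axis)
    also have "\<dots> = (\<chi> i. d i * x $ i)"
      by (simp add: vec_eq_iff axis_def if_distrib[of "\<lambda>z. _ * z"] cong: if_cong)
    finally show ?thesis by simp
  qed
  have [measurable]: "(\<lambda>x. \<chi> i. d i * x $ i) \<in> borel_measurable (borel :: (real^'n) measure)"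
    by (intro borel_measurable_continuous_onI continuous_intros)
  have "lborel = density (distr lborel borel (\<lambda>x. 0 + (\<Sum>j\<in>Basis. (c j * (x \<bullet> j)) *\<^sub>R j))) (\<lambda>_. ennreal (\<Prod>j\<in>Basis. \<bar>c j\<bar>))"
    by (rule lborel_affine_euclidean) (use d in \<open>auto simp: B c\<close>)
  also have "(\<Prod>j\<in>Basis. \<bar>c j\<bar>) = \<bar>\<Prod>i\<in>UNIV. d i\<bar>"
    by (simp add: B prod.reindex[OF inj] c abs_prod)
  finally have "lborel = density (distr lborel borel (\<lambda>x. \<chi> i. d i * x $ i)) (\<lambda>_. ennreal \<bar>\<Prod>i\<in>UNIV. d i\<bar>)"
    by (simp only: T)
  then have "(\<integral>\<^sup>+x. f x \<partial>lborel)
      = (\<integral>\<^sup>+x. f x \<partial>density (distr lborel borel (\<lambda>x. \<chi> i. d i * x $ i)) (\<lambda>_. ennreal \<bar>\<Prod>i\<in>UNIV. d i\<bar>))"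
    by simp
  then show ?thesis by (simp add: nn_integral_density nn_integral_distr)
qed

text \<open>Diagonalization \<open>K = W ** D ** transpose W\<close> reduces the substitution to a
  rotation, a coordinatewise scaling and a rotation. Only the scaling contributes to the
  Jacobian.\<close>

lemma nn_integral_lborel_pos_def:
  fixes K :: "real^'n^'n"
  assumes K: "pos_def K" and f[measurable]: "f \<in> borel_measurable borel"
  shows "(\<integral>\<^sup>+x. f x \<partial>lborel) = (\<integral>\<^sup>+z. ennreal \<bar>det K\<bar> * f (K *v z) \<partial>lborel)"
proof -
  obtain B where B: "orthonormal_on B (\<lambda>x. x)" "\<And>b. b \<in> B \<Longrightarrow> K *v b = (b \<bullet> (K *v b)) *\<^sub>R b"
      "card B = CARD('n)" "finite B"
    using symmetric_eigenbasis[OF pos_def_symD[OF K]] by blast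
  obtain b where b: "bij_betw b (UNIV::'n set) B"
    using B(3,4) by (metis finite finite_same_card_bij)
  have bB: "b j \<in> B" for j using b by (auto simp: bij_betw_def)
  have bo: "orthonormal_on UNIV b"
    using orthonormal_on_reindex[OF B(1), of b UNIV] b by (auto simp: bij_betw_def)
  define W :: "real^'n^'n" where "W = (\<chi> i j. b j $ i)"
  define d where "d j = b j \<bullet> (K *v b j)" for j
  define D :: "real^'n^'n" where "D = (\<chi> i j. if i = j then d i else 0)"
  have d: "d j \<noteq> 0" for j
    using pos_defD[OF K, of "b j"] orthonormal_on_nonzero[OF bo, of j] by (auto simp: d_def)
  have "transpose W ** W = mat 1"
    using bo
    by (simp add: W_def matrix_matrix_mult_def transpose_def mat_def vec_eq_iff orthonormal_on_def inner_vec_def)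
  then have W: "orthogonal_matrix W" by (simp add: orthogonal_matrix)
  then have WT: "transpose W ** W = mat 1" "W ** transpose W = mat 1"
    by (auto simp: orthogonal_matrix_def)
  have "K ** W = W ** D"
  proof -
    have "(K ** W) $ i $ j = (W ** D) $ i $ j" for i j
    proof -
      have "(K ** W) $ i $ j = (K *v b j) $ i"
        by (simp add: W_def matrix_matrix_mult_def matrix_vector_mult_def)
      also have "\<dots> = (W ** D) $ i $ j"
        by (subst B(2)[OF bB[of j]])
           (simp add: W_def D_def d_def matrix_matrix_mult_def if_distrib[of "\<lambda>z. _ * z"] mult.commute cong: if_cong)
      finally show ?thesis .
    qed
    then show ?thesis by (simp add: vec_eq_iff)
  qed
  then have KW: "K = W ** D ** transpose W"
    by (metis WT(2) matrix_mul_assoc matrix_mul_rid)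
  have detK: "\<bar>det K\<bar> = \<bar>\<Prod>i\<in>UNIV. d i\<bar>"
  proof -
    have "det D = (\<Prod>i\<in>UNIV. d i)"
      by (subst det_diagonal) (auto simp: D_def)
    moreover have "det W * det W = 1"
      by (metis WT(1) det_I det_mul det_transpose)
    moreover have "det K = (det W * det W) * det D"
      by (simp add: KW det_mul)
    ultimately show ?thesis by simp
  qed
  have Dz: "D *v z = (\<chi> i. d i * z $ i)" for z
    by (simp add: D_def matrix_vector_mult_def vec_eq_iff if_distrib[of "\<lambda>z. z * _"] cong: if_cong)
  have "(\<integral>\<^sup>+x. f x \<partial>lborel) = (\<integral>\<^sup>+x. f (W *v x) \<partial>lborel)"
    by (rule nn_integral_lborel_orthogonal[OF W, symmetric]) measurable
  also have "\<dots> = (\<integral>\<^sup>+z. ennreal \<bar>det K\<bar> * f (W *v (D *v z)) \<partial>lborel)"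
    unfolding detK Dz by (rule nn_integral_lborel_diagonal[OF d]) measurable
  also have "\<dots> = (\<integral>\<^sup>+z. ennreal \<bar>det K\<bar> * f (W *v (D *v (transpose W *v z))) \<partial>lborel)"
    by (rule nn_integral_lborel_orthogonal[symmetric])
       (use W in \<open>simp_all add: orthogonal_matrix_def del: transpose_matrix_vector\<close>)
  finally show ?thesis
    by (simp add: KW matrix_vector_mul_assoc matrix_mul_assoc del: transpose_matrix_vector)
qed

lemma nn_integral_lborel_vec_prod:
  fixes f :: "'n::finite \<Rightarrow> real \<Rightarrow> ennreal"
  assumes f: "\<And>i. f i \<in> borel_measurable borel"
  shows "(\<integral>\<^sup>+z. (\<Prod>i\<in>UNIV. f i (z $ i)) \<partial>lborel) = (\<Prod>i\<in>UNIV. \<integral>\<^sup>+x. f i x \<partial>lborel)"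
proof -
  define g where "g b = f (THE i. b = axis i (1::real))" for b :: "real^'n"
  have g: "g (axis i 1) = f i" for i
    by (simp add: g_def axis_eq_axis)
  have B: "(Basis :: (real^'n) set) = (\<lambda>i. axis i 1) ` UNIV"
    by (auto simp: Basis_vec_def)
  have inj: "inj (\<lambda>i::'n. axis i (1::real))"
    by (auto simp: inj_def axis_eq_axis)
  have "(\<integral>\<^sup>+z. (\<Prod>b\<in>Basis. g b (z \<bullet> b)) \<partial>lborel) = (\<Prod>b\<in>Basis. \<integral>\<^sup>+x. g b x \<partial>lborel)"
    by (rule nn_integral_lborel_prod) (auto simp: B g f)
  then show ?thesis
    by (simp add: B prod.reindex[OF inj] g inner_axis)
qed

section \<open>Gaussian measures and their moments\<close>

abbreviation std_normal :: "real measure" where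
  "std_normal \<equiv> density lborel (\<lambda>x. ennreal (std_normal_density x))"

lemma nn_integral_std_normal_1: "(\<integral>\<^sup>+x. 1 \<partial>std_normal) = 1"
proof -
  interpret prob_space std_normal by (rule prob_space_normal_density) simp
  show ?thesis using emeasure_space_1 by simp
qed

text \<open>Under \<open>N(0, C)\<close>, linear functionals that are orthonormal for the form \<open>C\<close> are independent
  standard normal variables: \<open>R\<close> below is a square root of \<open>C\<close>, rotated so that these
  functionals become coordinates.\<close>

lemma nn_integral_gaussian_prod:
  fixes C :: "real^'n^'n"
  assumes C: "pos_def C" and I: "finite I"
    and l: "\<And>i j. i \<in> I \<Longrightarrow> j \<in> I \<Longrightarrow> l i \<bullet> (C *v l j) = (if i = j then 1 else 0)"
    and f: "\<And>i. i \<in> I \<Longrightarrow> f i \<in> borel_measurable borel"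
  shows "(\<integral>\<^sup>+w. (\<Prod>i\<in>I. f i (l i \<bullet> w)) \<partial>gaussian C) = (\<Prod>i\<in>I. \<integral>\<^sup>+x. f i x \<partial>std_normal)"
proof -
  define K where "K = mat_sqrt C"
  have K: "transpose K = K" "K ** K = C"
    using mat_sqrt[OF C] pos_def_symD by (auto simp: K_def)
  have "orthonormal_on I (\<lambda>i. K *v l i)"
    unfolding orthonormal_on_def
    by (simp add: l symmetric_inner[OF K(1)] matrix_vector_mul_assoc K(2))
  then obtain W :: "real^'n^'n" and p where W: "orthogonal_matrix W" and p: "inj_on p I"
    and Wp: "\<And>i. i \<in> I \<Longrightarrow> transpose W *v (K *v l i) = axis (p i) 1"
    using orthonormal_on_basis_index by blast
  define R where "R = K ** W"
  have tR: "transpose R = transpose W ** K"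
    by (simp add: R_def matrix_transpose_mul K)
  have "W ** transpose W = mat 1" using W by (simp add: orthogonal_matrix_def)
  then have RR: "R ** transpose R = C"
    by (metis (no_types, lifting) K(2) R_def matrix_mul_assoc matrix_mul_lid tR)
  have lR: "l i \<bullet> (R *v z) = z $ p i" if "i \<in> I" for i z
  proof -
    have "l i \<bullet> (R *v z) = (transpose R *v l i) \<bullet> z"
      by (simp add: dot_lmul_matrix)
    also have "transpose R *v l i = axis (p i) 1"
      using Wp[OF that] by (simp add: tR matrix_vector_mul_assoc)
    finally show ?thesis by (simp add: inner_axis')
  qed
  have prod_lR: "(\<Prod>i\<in>I. f i (l i \<bullet> (R *v z))) = (\<Prod>i\<in>I. f i (z $ p i))" for z
    by (intro prod.cong) (simp_all add: lR)
  have detC: "det C = (det R)\<^sup>2"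
    by (metis RR det_mul det_transpose power2_eq_square)
  have "det C \<noteq> 0" using pos_def_invertible[OF C] invertible_det_nz by blast
  then have detR: "det R \<noteq> 0" by (simp add: detC)
  have detRK: "\<bar>det R\<bar> = \<bar>det K\<bar>"
    using det_orthogonal_matrix[OF W] by (auto simp: R_def det_mul)
  obtain R' where R': "R' ** R = mat 1" "R ** R' = mat 1"
    using detR invertible_det_nz[of R] by (auto simp: invertible_def)
  \<comment> \<open>In the coordinates \<open>w = R *v z\<close> the exponent of the density is that
    of a standard normal vector, since \<open>R ** transpose R = C\<close>.\<close>
  have quad: "(R *v z) \<bullet> (matrix_inv C *v (R *v z)) = z \<bullet> z" for z
  proof -
    define y where "y = transpose R' *v z"
    have y: "transpose R *v y = z"
      using R'(1) by (metis matrix_transpose_mul matrix_vector_mul_assoc matrix_vector_mul_lid transpose_mat y_def)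
    then have "C *v y = R *v z"
      by (metis RR matrix_vector_mul_assoc)
    then have "matrix_inv C *v (R *v z) = y"
      using pos_def_matrix_inv(2)[OF C] by (metis matrix_vector_mul_assoc matrix_vector_mul_lid)
    moreover have "(R *v z) \<bullet> y = z \<bullet> (transpose R *v y)"
      by (simp add: dot_lmul_matrix[symmetric] inner_commute)
    ultimately show ?thesis using y by simp
  qed
  \<comment> \<open>Coordinates that belong to no functional receive the constant 1, whose integral
    under the standard normal distribution is 1.\<close>
  define g where "g j = (if j \<in> p ` I then f (inv_into I p j) else (\<lambda>_. 1))" for j
  have g[measurable]: "g j \<in> borel_measurable borel" for j
    using f by (auto simp: g_def p)
  have gp: "g (p i) = f i" if "i \<in> I" for i
    using that p by (simp add: g_def)
  have prodI: "(\<Prod>i\<in>I. F (p i)) = (\<Prod>j\<in>UNIV. F j)" if "\<And>j. j \<notin> p ` I \<Longrightarrow> F j = 1" for F :: "'n \<Rightarrow> ennreal"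
  proof -
    have "(\<Prod>i\<in>I. F (p i)) = (\<Prod>j\<in>p ` I. F j)"
      using prod.reindex[OF p, of F] by simp
    also have "\<dots> = (\<Prod>j\<in>UNIV. F j)"
      by (rule prod.mono_neutral_left) (use that in auto)
    finally show ?thesis .
  qed
  have [measurable]: "(\<lambda>w. \<Prod>i\<in>I. f i (l i \<bullet> w)) \<in> borel_measurable borel"
    by (intro borel_measurable_prod_ennreal measurable_compose[OF _ f]) auto
  define c where "c = sqrt ((2 * pi) ^ CARD('n) * det C)"
  \<comment> \<open>The factor \<open>\<bar>det R\<bar>\<close> cancels against the Jacobian of the
    substitution; what is left normalizes the standard normal densities.\<close>
  have c: "c = sqrt (2 * pi) ^ CARD('n) * \<bar>det R\<bar>"
    unfolding c_def detC real_sqrt_mult[of "_ ^ CARD('n)"] real_sqrt_power[of "2 * pi"] by simp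
  have "(\<integral>\<^sup>+w. (\<Prod>i\<in>I. f i (l i \<bullet> w)) \<partial>gaussian C)
      = (\<integral>\<^sup>+w. ennreal (exp (- (w \<bullet> (matrix_inv C *v w)) / 2) / c) * (\<Prod>i\<in>I. f i (l i \<bullet> w)) \<partial>lborel)"
    unfolding gaussian_def c_def by (rule nn_integral_density) simp_all
  also have "\<dots> = (\<integral>\<^sup>+z. ennreal \<bar>det R\<bar> * (ennreal (exp (- (z \<bullet> z) / 2) / c) * (\<Prod>i\<in>I. f i (z $ p i))) \<partial>lborel)"
    (is "integral\<^sup>N lborel ?F = _")
  proof -
    \<comment> \<open>The two factors of \<open>R = K ** W\<close> are substituted one after the
      other: the positive-definite one and the orthogonal one.\<close>
    have [measurable]: "?F \<in> borel_measurable borel" by measurable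
    have "integral\<^sup>N lborel ?F = (\<integral>\<^sup>+y. ennreal \<bar>det K\<bar> * ?F (K *v y) \<partial>lborel)"
      using mat_sqrt(1)[OF C] by (intro nn_integral_lborel_pos_def) (auto simp: K_def)
    also have "\<dots> = (\<integral>\<^sup>+z. ennreal \<bar>det K\<bar> * ?F (K *v (W *v z)) \<partial>lborel)"
      by (rule nn_integral_lborel_orthogonal[OF W, symmetric]) measurable
    finally show ?thesis
      by (simp only: matrix_vector_mul_assoc[of K W] R_def[symmetric] detRK[symmetric] quad prod_lR)
  qed
  also have "\<dots> = (\<integral>\<^sup>+z. (\<Prod>j\<in>UNIV. ennreal (std_normal_density (z $ j)) * g j (z $ j)) \<partial>lborel)"
  proof (rule nn_integral_cong)
    fix z :: "real^'n"
    have "(\<Prod>j\<in>UNIV. std_normal_density (z $ j)) = exp (- (z \<bullet> z) / 2) / sqrt (2 * pi) ^ CARD('n)"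
      by (simp add: std_normal_density_def prod_dividef inner_vec_def power2_eq_square sum_negf
          flip: exp_sum sum_divide_distrib)
    also have "\<dots> = \<bar>det R\<bar> * (exp (- (z \<bullet> z) / 2) / c)"
      using detR by (simp add: c)
    finally have "(\<Prod>j\<in>UNIV. ennreal (std_normal_density (z $ j))) = ennreal (\<bar>det R\<bar> * (exp (- (z \<bullet> z) / 2) / c))"
      by (subst prod_ennreal) (simp_all only: normal_density_nonneg)
    also have "\<dots> = ennreal \<bar>det R\<bar> * ennreal (exp (- (z \<bullet> z) / 2) / c)"
      by (intro ennreal_mult) (auto simp: c)
    finally have 1: "(\<Prod>j\<in>UNIV. ennreal (std_normal_density (z $ j))) = ennreal \<bar>det R\<bar> * ennreal (exp (- (z \<bullet> z) / 2) / c)" .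
    have "(\<Prod>i\<in>I. f i (z $ p i)) = (\<Prod>i\<in>I. g (p i) (z $ p i))"
      by (simp add: gp cong: prod.cong)
    also have "\<dots> = (\<Prod>j\<in>UNIV. g j (z $ j))"
      by (rule prodI) (simp add: g_def)
    finally show "ennreal \<bar>det R\<bar> * (ennreal (exp (- (z \<bullet> z) / 2) / c) * (\<Prod>i\<in>I. f i (z $ p i)))
        = (\<Prod>j\<in>UNIV. ennreal (std_normal_density (z $ j)) * g j (z $ j))"
      by (simp add: prod.distrib 1 mult.assoc)
  qed
  also have "\<dots> = (\<Prod>j\<in>UNIV. \<integral>\<^sup>+x. ennreal (std_normal_density x) * g j x \<partial>lborel)"
    by (rule nn_integral_lborel_vec_prod) measurable
  also have "\<dots> = (\<Prod>j\<in>UNIV. \<integral>\<^sup>+x. g j x \<partial>std_normal)"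
    by (simp add: nn_integral_density)
  also have "\<dots> = (\<Prod>i\<in>I. \<integral>\<^sup>+x. g (p i) x \<partial>std_normal)"
    by (rule prodI[symmetric]) (simp add: g_def nn_integral_std_normal_1 del: nn_integral_const)
  also have "\<dots> = (\<Prod>i\<in>I. \<integral>\<^sup>+x. f i x \<partial>std_normal)"
    by (simp add: gp cong: prod.cong)
  finally show ?thesis .
qed

lemma sets_gaussian [simp, measurable_cong]: "sets (gaussian C) = sets borel"
  by (simp add: gaussian_def)

lemma space_gaussian [simp]: "space (gaussian C) = UNIV"
  by (simp add: gaussian_def)

text \<open>The product formula for the empty family says that the total mass is 1.\<close>

lemma prob_space_gaussian: "pos_def C \<Longrightarrow> prob_space (gaussian C)"
  using nn_integral_gaussian_prod[of C "{}" undefined undefined]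
  by (intro prob_spaceI) simp

text \<open>After normalization \<open>a\<close> is a one-element orthonormal family for the form
  \<open>C\<close>; \<open>a = 0\<close> cannot be normalized and is treated separately.\<close>

lemma nn_integral_gaussian_functional:
  fixes C :: "real^'n^'n"
  assumes C: "pos_def C" and f[measurable]: "f \<in> borel_measurable borel"
  shows "(\<integral>\<^sup>+w. f (a \<bullet> w) \<partial>gaussian C) = (\<integral>\<^sup>+x. f (sqrt (a \<bullet> (C *v a)) * x) \<partial>std_normal)"
proof (cases "a = 0")
  case True
  interpret prob_space "gaussian C" by (rule prob_space_gaussian[OF C])
  show ?thesis
    using True emeasure_space_1 emeasure_space_1[symmetric] nn_integral_std_normal_1 by simp
next
  case False
  define c where "c = sqrt (a \<bullet> (C *v a))"
  have c: "0 < c" "c * c = a \<bullet> (C *v a)"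
    using pos_defD[OF C False] by (simp_all add: c_def)
  define l where "l = (1 / c) *\<^sub>R a"
  have "l \<bullet> (C *v l) = 1"
    using c by (simp add: l_def matrix_vector_mult_scaleR flip: c(2))
  then have "(\<integral>\<^sup>+w. (\<Prod>i\<in>{()}. f (c * (l \<bullet> w))) \<partial>gaussian C) = (\<Prod>i\<in>{()}. \<integral>\<^sup>+x. f (c * x) \<partial>std_normal)"
    by (intro nn_integral_gaussian_prod[OF C]) auto
  then show ?thesis
    using c(1) by (simp add: l_def c_def)
qed

text \<open>Completing the square turns the integrand into a multiple of the normal density with
  mean \<open>c\<close>.\<close>

lemma nn_integral_std_normal_exp:
  "(\<integral>\<^sup>+x. ennreal (exp (c * x)) \<partial>std_normal) = ennreal (exp (c\<^sup>2 / 2))"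
proof -
  have eq: "std_normal_density x * exp (c * x) = exp (c\<^sup>2 / 2) * normal_density c 1 x" for x
    by (simp add: std_normal_density_def normal_density_def power2_diff field_simps flip: exp_add)
  have "(\<integral>\<^sup>+x. ennreal (exp (c * x)) \<partial>std_normal)
      = (\<integral>\<^sup>+x. ennreal (exp (c\<^sup>2 / 2)) * ennreal (normal_density c 1 x) \<partial>lborel)"
    by (simp add: nn_integral_density eq flip: ennreal_mult)
  also have "\<dots> = ennreal (exp (c\<^sup>2 / 2)) * (\<integral>\<^sup>+x. 1 \<partial>density lborel (normal_density c 1))"
    by (simp add: nn_integral_cmult emeasure_density)
  also have "(\<integral>\<^sup>+x. 1 \<partial>density lborel (normal_density c 1)) = 1"
  proof -
    interpret prob_space "density lborel (normal_density c 1)" by (rule prob_space_normal_density) simp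
    show ?thesis using emeasure_space_1 by simp
  qed
  finally show ?thesis by simp
qed

text \<open>For \<open>s < 1\<close> the integrand is a multiple of a normal density with variance
  \<open>1 / (1 - s^2)\<close>. For \<open>s \<ge> 1\<close> it is bounded below by a positive
  constant. This is the source of the constraint that finite loss puts on the singular
  values.\<close>

lemma nn_integral_std_normal_exp_square:
  assumes "0 \<le> s"
  shows "(\<integral>\<^sup>+x. ennreal (exp ((s * x)\<^sup>2 / 2)) \<partial>std_normal)
    = (if s < 1 then ennreal (1 / sqrt (1 - s\<^sup>2)) else \<infinity>)"
proof (cases "s < 1")
  case True
  have s: "0 < 1 - s\<^sup>2" using assms True by (simp add: abs_square_less_1)
  define t where "t = 1 / sqrt (1 - s\<^sup>2)"
  have t: "0 < t" "t\<^sup>2 = 1 / (1 - s\<^sup>2)" using s by (simp_all add: t_def power_divide)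
  have eq: "std_normal_density x * exp ((s * x)\<^sup>2 / 2) = t * normal_density 0 t x" for x
  proof -
    have "sqrt (2 * pi * t\<^sup>2) = sqrt (2 * pi) * t" using t(1) by (simp add: real_sqrt_mult)
    moreover have "- x\<^sup>2 / 2 + (s * x)\<^sup>2 / 2 = - x\<^sup>2 / (2 * t\<^sup>2)"
      using s by (simp add: t(2) power_mult_distrib field_simps)
    ultimately show ?thesis using t(1)
      by (simp add: std_normal_density_def normal_density_def flip: exp_add)
  qed
  have "(\<integral>\<^sup>+x. ennreal (exp ((s * x)\<^sup>2 / 2)) \<partial>std_normal)
      = (\<integral>\<^sup>+x. ennreal t * ennreal (normal_density 0 t x) \<partial>lborel)"
    using t(1) by (simp add: nn_integral_density eq flip: ennreal_mult)
  also have "\<dots> = ennreal t * (\<integral>\<^sup>+x. 1 \<partial>density lborel (normal_density 0 t))"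
    by (simp add: nn_integral_cmult emeasure_density)
  also have "(\<integral>\<^sup>+x. 1 \<partial>density lborel (normal_density 0 t)) = 1"
  proof -
    interpret prob_space "density lborel (normal_density 0 t)" by (rule prob_space_normal_density) (rule t)
    show ?thesis using emeasure_space_1 by simp
  qed
  finally show ?thesis using True by (simp add: t_def)
next
  case False
  have le: "1 / sqrt (2 * pi) \<le> std_normal_density x * exp ((s * x)\<^sup>2 / 2)" for x
  proof -
    have "x\<^sup>2 \<le> (s * x)\<^sup>2" using False by (simp add: power_mult_distrib mult_le_cancel_right1)
    then have "1 \<le> exp (- x\<^sup>2 / 2 + (s * x)\<^sup>2 / 2)" by simp
    then show ?thesis
      by (simp add: std_normal_density_def divide_right_mono flip: exp_add)
  qed
  have "\<infinity> = (\<integral>\<^sup>+x. ennreal (1 / sqrt (2 * pi)) \<partial>(lborel :: real measure))"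
    by (simp add: ennreal_mult_top)
  also have "\<dots> \<le> (\<integral>\<^sup>+x. ennreal (std_normal_density x * exp ((s * x)\<^sup>2 / 2)) \<partial>lborel)"
    using le by (intro nn_integral_mono ennreal_leI)
  also have "\<dots> = (\<integral>\<^sup>+x. ennreal (exp ((s * x)\<^sup>2 / 2)) \<partial>std_normal)"
    by (simp add: nn_integral_density ennreal_mult)
  finally show ?thesis using False by (simp add: top_unique)
qed

lemma nn_integral_std_normal_square: "(\<integral>\<^sup>+x. ennreal (x\<^sup>2) \<partial>std_normal) = 1"
proof -
  have "has_bochner_integral lborel (\<lambda>x. std_normal_density x * x\<^sup>2) 1"
    using std_normal_moment_even[of 1] by simp
  then have "(\<integral>\<^sup>+x. ennreal (std_normal_density x * x\<^sup>2) \<partial>lborel) = ennreal 1"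
    by (intro nn_integral_eq_integral[THEN trans]) (auto simp: has_bochner_integral_iff)
  then show ?thesis by (simp add: nn_integral_density ennreal_mult)
qed

text \<open>Variances come from the one-dimensional reduction, mixed moments by
  polarization.\<close>

lemma gaussian_second_moment:
  fixes C :: "real^'n^'n"
  assumes C: "pos_def C"
  shows "has_bochner_integral (gaussian C) (\<lambda>w. (a \<bullet> w) * (b \<bullet> w)) (a \<bullet> (C *v b))"
proof -
  have sq: "has_bochner_integral (gaussian C) (\<lambda>w. (a \<bullet> w)\<^sup>2) (a \<bullet> (C *v a))" for a
  proof (rule has_bochner_integral_nn_integral)
    have nn: "0 \<le> a \<bullet> (C *v a)"
      using pos_defD[OF C, of a] by (cases "a = 0") auto
    then show "0 \<le> a \<bullet> (C *v a)" .
    have "(\<integral>\<^sup>+w. ennreal ((a \<bullet> w)\<^sup>2) \<partial>gaussian C)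
        = (\<integral>\<^sup>+x. ennreal (a \<bullet> (C *v a)) * ennreal (x\<^sup>2) \<partial>std_normal)"
      using nn by (subst nn_integral_gaussian_functional[OF C]) (auto simp: power_mult_distrib ennreal_mult)
    also have "\<dots> = ennreal (a \<bullet> (C *v a))"
      by (simp add: nn_integral_cmult nn_integral_std_normal_square)
    finally show "(\<integral>\<^sup>+w. ennreal ((a \<bullet> w)\<^sup>2) \<partial>gaussian C) = ennreal (a \<bullet> (C *v a))" .
  qed (auto intro: borel_measurable_continuous_onI continuous_intros)
  have "has_bochner_integral (gaussian C) (\<lambda>w. (((a + b) \<bullet> w)\<^sup>2 - ((a - b) \<bullet> w)\<^sup>2) / 4)
      (((a + b) \<bullet> (C *v (a + b)) - (a - b) \<bullet> (C *v (a - b))) / 4)"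
    by (intro has_bochner_integral_divide has_bochner_integral_diff sq)
  moreover have "(((a + b) \<bullet> w)\<^sup>2 - ((a - b) \<bullet> w)\<^sup>2) / 4 = (a \<bullet> w) * (b \<bullet> w)" for w
    by (simp add: inner_add_left inner_diff_left power2_eq_square algebra_simps)
  moreover have "((a + b) \<bullet> (C *v (a + b)) - (a - b) \<bullet> (C *v (a - b))) / 4 = a \<bullet> (C *v b)"
    using symmetric_inner[OF pos_def_symD[OF C], of a b]
    by (simp add: inner_add_left inner_diff_left inner_add_right inner_diff_right inner_commute
        matrix_vector_mult_add_rdistrib matrix_vector_mult_diff_distrib matrix_vector_right_distrib)
  ultimately show ?thesis by simp
qed

subsection \<open>The loss in terms of a singular value decomposition\<close>

text \<open>Extension by zero: inner products with \<open>vec_inl a\<close> and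
  \<open>vec_inr b\<close> are the functionals of the first and of the second component, so that
  integrals over either marginal become integrals over \<open>gaussian C\<close>.\<close>

definition vec_inl :: "real^'u \<Rightarrow> real^('u::finite + 'v::finite)" where
  "vec_inl a = (\<chi> k. case k of Inl i \<Rightarrow> a $ i | Inr _ \<Rightarrow> 0)"

definition vec_inr :: "real^'v \<Rightarrow> real^('u::finite + 'v::finite)" where
  "vec_inr b = (\<chi> k. case k of Inl _ \<Rightarrow> 0 | Inr j \<Rightarrow> b $ j)"

lemma sum_UNIV_sum_type:
  "(\<Sum>k\<in>(UNIV::('u::finite + 'v::finite) set). f k) = (\<Sum>i\<in>UNIV. f (Inl i)) + (\<Sum>j\<in>UNIV. f (Inr j))"
  by (subst UNIV_Plus_UNIV[symmetric], subst sum.Plus) simp_all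

lemma inner_vec_inl: "vec_inl a \<bullet> w = a \<bullet> (\<chi> i. w $ Inl i)"
  by (simp add: inner_vec_def vec_inl_def sum_UNIV_sum_type)

lemma inner_vec_inr: "vec_inr b \<bullet> w = b \<bullet> (\<chi> j. w $ Inr j)"
  by (simp add: inner_vec_def vec_inr_def sum_UNIV_sum_type)

lemma inner_block_uu: "vec_inl a \<bullet> (C *v vec_inl a') = a \<bullet> (block_uu C *v a')"
  unfolding inner_vec_inl
  by (simp add: matrix_vector_mult_def vec_inl_def block_uu_def sum_UNIV_sum_type)

lemma inner_block_uv: "vec_inl a \<bullet> (C *v vec_inr b) = a \<bullet> (block_uv C *v b)"
  unfolding inner_vec_inl
  by (simp add: matrix_vector_mult_def vec_inr_def block_uv_def sum_UNIV_sum_type)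

lemma inner_block_vv: "vec_inr b \<bullet> (C *v vec_inr b') = b \<bullet> (block_vv C *v b')"
  unfolding inner_vec_inr
  by (simp add: matrix_vector_mult_def vec_inr_def block_vv_def sum_UNIV_sum_type)

lemma pos_def_block_uu:
  assumes C: "pos_def C" shows "pos_def (block_uu C)"
  unfolding pos_def_def
proof (intro conjI allI impI)
  show "transpose (block_uu C) = block_uu C"
    using pos_def_symD[OF C] by (simp add: block_uu_def transpose_def vec_eq_iff)
  fix a :: "real^'a" assume "a \<noteq> 0"
  then have "vec_inl a \<noteq> (0 :: real^('a + 'b))"
    by (auto simp: vec_eq_iff vec_inl_def split: sum.split)
  from pos_defD[OF C this] show "0 < a \<bullet> (block_uu C *v a)" by (simp add: inner_block_uu)
qed

lemma pos_def_block_vv: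
  assumes C: "pos_def C" shows "pos_def (block_vv C)"
  unfolding pos_def_def
proof (intro conjI allI impI)
  show "transpose (block_vv C) = block_vv C"
    using pos_def_symD[OF C] by (simp add: block_vv_def transpose_def vec_eq_iff)
  fix a :: "real^'b" assume "a \<noteq> 0"
  then have "vec_inr a \<noteq> (0 :: real^('a + 'b))"
    by (auto simp: vec_eq_iff vec_inr_def split: sum.split)
  from pos_defD[OF C this] show "0 < a \<bullet> (block_vv C *v a)" by (simp add: inner_block_vv)
qed

text \<open>The cross-covariance of the two components after each is normalized to identity
  covariance; its singular values are the canonical correlations.\<close>

definition whitened :: "real^('u::finite + 'v::finite)^('u + 'v) \<Rightarrow> real^'v^'u" where
  "whitened C = mat_inv_sqrt (block_uu C) ** block_uv C ** mat_inv_sqrt (block_vv C)"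

text \<open>The logarithm of the integral \<open>1 / sqrt (1 - s^2)\<close>: the contribution of one
  singular value to the log-expectation.\<close>

definition phi :: "real \<Rightarrow> real" where "phi s = - ln (1 - s\<^sup>2) / 2"

lemma mat_inv_sqrt:
  assumes "pos_def M"
  shows "transpose (mat_inv_sqrt M) = mat_inv_sqrt M"
    "mat_inv_sqrt M ** mat_sqrt M = mat 1" "mat_sqrt M ** mat_inv_sqrt M = mat 1"
  using pos_def_matrix_inv[OF mat_sqrt(1)[OF assms]] by auto

lemma inner_mat_inv_sqrt:
  assumes M: "pos_def M"
  shows "(mat_inv_sqrt M *v a) \<bullet> (M *v (mat_inv_sqrt M *v b)) = a \<bullet> b"
proof -
  have "(mat_inv_sqrt M *v a) \<bullet> (M *v (mat_inv_sqrt M *v b))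
      = a \<bullet> ((mat_inv_sqrt M ** (mat_sqrt M ** mat_sqrt M) ** mat_inv_sqrt M) *v b)"
    by (simp add: symmetric_inner[OF mat_inv_sqrt(1)[OF M]] mat_sqrt(2)[OF M] matrix_vector_mul_assoc matrix_mul_assoc)
  also have "mat_inv_sqrt M ** (mat_sqrt M ** mat_sqrt M) ** mat_inv_sqrt M = mat 1"
    by (metis mat_inv_sqrt(2,3)[OF M] matrix_mul_assoc matrix_mul_lid)
  finally show ?thesis by simp
qed

lemma quadratic_form_sum:
  fixes M :: "real^'n^'n"
  assumes "finite I" "\<And>i j. i \<in> I \<Longrightarrow> j \<in> I \<Longrightarrow> k i \<bullet> (M *v k j) = (if i = j then 1 else 0)"
  shows "(\<Sum>i\<in>I. c i *\<^sub>R k i) \<bullet> (M *v (\<Sum>i\<in>I. c i *\<^sub>R k i)) = (\<Sum>i\<in>I. (c i)\<^sup>2)"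
proof -
  have "(\<Sum>i\<in>I. c i *\<^sub>R k i) \<bullet> (M *v (\<Sum>i\<in>I. c i *\<^sub>R k i))
      = (\<Sum>i\<in>I. \<Sum>j\<in>I. c i * c j * (k i \<bullet> (M *v k j)))"
    by (simp add: linear_sum[OF matrix_vector_mul_linear] matrix_vector_mult_scaleR
        inner_sum_left inner_sum_right sum_distrib_left ac_simps)
       (subst sum.swap, simp add: ac_simps)
  also have "\<dots> = (\<Sum>i\<in>I. \<Sum>j\<in>I. if i = j then (c i)\<^sup>2 else 0)"
    by (intro sum.cong) (auto simp: assms(2) power2_eq_square)
  finally show ?thesis using assms(1) by simp
qed

lemma ext_log_ennreal: "0 < t \<Longrightarrow> ext_log (ennreal t) = ereal (ln t)"
  by (simp add: ext_log_def ennreal_eq_0_iff)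

text \<open>Evaluates the loss at every matrix, since undoing the whitening and
  \<open>ex_svd\<close> bring any matrix to this form. The functionals \<open>l i\<close> are
  orthonormal for the form \<open>C\<close>, so are the \<open>k i\<close>, and the covariance of
  \<open>l i\<close> with \<open>k i\<close> is
  \<open>x i \<bullet> (whitened C *v y i)\<close>.\<close>

lemma L_joint_dyadic_sum:
  fixes C :: "real^('u::finite + 'v::finite)^('u + 'v)"
  assumes C: "pos_def C" and I: "finite I" and x: "orthonormal_on I x" and y: "orthonormal_on I y"
    and s: "\<And>i. i \<in> I \<Longrightarrow> 0 \<le> s i"
  shows "L_joint (joint_gaussian C)
      (mat_inv_sqrt (block_uu C) ** dyadic_sum I s x y ** mat_inv_sqrt (block_vv C))
    = (if \<forall>i\<in>I. s i < 1 then ereal (\<Sum>i\<in>I. phi (s i) - s i * (x i \<bullet> (whitened C *v y i))) else \<infinity>)"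
proof -
  define P where "P = mat_inv_sqrt (block_uu C)"
  define Q where "Q = mat_inv_sqrt (block_vv C)"
  note Cu = pos_def_block_uu[OF C] and Cv = pos_def_block_vv[OF C]
  define A where "A = P ** dyadic_sum I s x y ** Q"
  define l :: "_ \<Rightarrow> real^('u + 'v)" where "l i = vec_inl (P *v x i)" for i
  define k :: "_ \<Rightarrow> real^('u + 'v)" where "k i = vec_inr (Q *v y i)" for i
  define pu :: "real^('u + 'v) \<Rightarrow> real^'u" where "pu w = (\<chi> i. w $ Inl i)" for w
  define pv :: "real^('u + 'v) \<Rightarrow> real^'v" where "pv w = (\<chi> j. w $ Inr j)" for w
  interpret G: prob_space "gaussian C" by (rule prob_space_gaussian[OF C])
  have [measurable]: "pu \<in> borel_measurable borel" "pv \<in> borel_measurable borel"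
    unfolding pu_def pv_def by (intro borel_measurable_continuous_onI continuous_intros)+
  have lw: "l i \<bullet> w = x i \<bullet> (P *v pu w)" for i w
    by (simp add: l_def pu_def inner_vec_inl P_def symmetric_inner[OF mat_inv_sqrt(1)[OF Cu]])
  have kw: "k i \<bullet> w = y i \<bullet> (Q *v pv w)" for i w
    by (simp add: k_def pv_def inner_vec_inr Q_def symmetric_inner[OF mat_inv_sqrt(1)[OF Cv]])
  have Auv: "u \<bullet> (A *v v) = (\<Sum>i\<in>I. s i * (x i \<bullet> (P *v u)) * (y i \<bullet> (Q *v v)))" for u v
  proof -
    have "u \<bullet> (A *v v) = (P *v u) \<bullet> (dyadic_sum I s x y *v (Q *v v))"
      by (simp add: A_def P_def symmetric_inner[OF mat_inv_sqrt(1)[OF Cu]] flip: matrix_vector_mul_assoc)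
    then show ?thesis
      by (simp add: dyadic_sum_mult inner_sum_right inner_commute[of "P *v u"] ac_simps)
  qed
  have ll: "l i \<bullet> (C *v l j) = (if i = j then 1 else 0)" if "i \<in> I" "j \<in> I" for i j
    using that x by (simp add: l_def inner_block_uu P_def inner_mat_inv_sqrt[OF Cu] orthonormal_onD)
  have kk: "k i \<bullet> (C *v k j) = (if i = j then 1 else 0)" if "i \<in> I" "j \<in> I" for i j
    using that y by (simp add: k_def inner_block_vv Q_def inner_mat_inv_sqrt[OF Cv] orthonormal_onD)
  have lk: "l i \<bullet> (C *v k i) = x i \<bullet> (whitened C *v y i)" for i
    by (simp add: l_def k_def inner_block_uv whitened_def P_def Q_def
        symmetric_inner[OF mat_inv_sqrt(1)[OF Cu]] matrix_vector_mul_assoc matrix_mul_assoc)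
  have expect: "(\<integral>(u, v). u \<bullet> (A *v v) \<partial>joint_gaussian C) = (\<Sum>i\<in>I. s i * (x i \<bullet> (whitened C *v y i)))"
  proof -
    have [measurable]: "(\<lambda>(u, v). u \<bullet> (A *v v)) \<in> borel_measurable borel"
      by (simp add: borel_prod[symmetric])
    have "(\<integral>(u, v). u \<bullet> (A *v v) \<partial>joint_gaussian C) = (\<integral>w. (\<Sum>i\<in>I. s i * ((l i \<bullet> w) * (k i \<bullet> w))) \<partial>gaussian C)"
      unfolding joint_gaussian_def pu_def[symmetric] pv_def[symmetric]
      by (subst integral_distr) (auto simp: borel_prod[symmetric] Auv lw kw mult.assoc)
    also have "\<dots> = (\<Sum>i\<in>I. s i * (x i \<bullet> (whitened C *v y i)))"
      unfolding lk[symmetric]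
      by (intro has_bochner_integral_integral_eq has_bochner_integral_sum has_bochner_integral_mult_right
          gaussian_second_moment[OF C])
    finally show ?thesis .
  qed
  have inner: "(\<integral>\<^sup>+w'. ennreal (exp (pu w \<bullet> (A *v pv w'))) \<partial>gaussian C)
      = (\<Prod>i\<in>I. ennreal (exp ((s i * (l i \<bullet> w))\<^sup>2 / 2)))" for w
  proof -
    \<comment> \<open>For fixed \<open>w\<close> the exponent is a linear functional of
      \<open>w'\<close>; its variance is a sum of squares because the \<open>k i\<close> are
      orthonormal for the form \<open>C\<close>.\<close>
    define a where "a = (\<Sum>i\<in>I. (s i * (l i \<bullet> w)) *\<^sub>R k i)"
    have "a \<bullet> (C *v a) = (\<Sum>i\<in>I. (s i * (l i \<bullet> w))\<^sup>2)"
      unfolding a_def by (rule quadratic_form_sum[OF I kk])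
    moreover have "pu w \<bullet> (A *v pv w') = a \<bullet> w'" for w'
      by (simp add: Auv a_def inner_sum_left lw kw)
    ultimately have "(\<integral>\<^sup>+w'. ennreal (exp (pu w \<bullet> (A *v pv w'))) \<partial>gaussian C)
        = ennreal (exp ((\<Sum>i\<in>I. (s i * (l i \<bullet> w))\<^sup>2) / 2))"
      by (simp add: nn_integral_gaussian_functional[OF C, of "\<lambda>t. ennreal (exp t)"] nn_integral_std_normal_exp
          sum_nonneg)
    then show ?thesis
      by (simp add: sum_divide_distrib exp_sum[OF I] prod_ennreal)
  qed
  have "(\<integral>\<^sup>+(u, v). ennreal (exp (u \<bullet> (A *v v)))
        \<partial>(distr (joint_gaussian C) borel fst \<Otimes>\<^sub>M distr (joint_gaussian C) borel snd))
      = (\<integral>\<^sup>+w. \<integral>\<^sup>+w'. ennreal (exp (pu w \<bullet> (A *v pv w'))) \<partial>gaussian C \<partial>gaussian C)"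
  proof -
    \<comment> \<open>Both marginals are images of \<open>gaussian C\<close>, so two independent
      copies \<open>w\<close> and \<open>w'\<close> of that measure realize their product.\<close>
    have 1: "distr (joint_gaussian C) borel fst = distr (gaussian C) borel pu"
      unfolding joint_gaussian_def pu_def[symmetric] pv_def[symmetric]
      by (subst distr_distr) (auto simp: borel_prod[symmetric] comp_def)
    have 2: "distr (joint_gaussian C) borel snd = distr (gaussian C) borel pv"
      unfolding joint_gaussian_def pu_def[symmetric] pv_def[symmetric]
      by (subst distr_distr) (auto simp: borel_prod[symmetric] comp_def)
    interpret V: prob_space "distr (gaussian C) borel pv"
      by (rule G.prob_space_distr) simp
    show ?thesis
      unfolding 1 2
      by (subst V.nn_integral_fst[symmetric]) (simp_all add: nn_integral_distr)
  qed
  also have "\<dots> = (\<Prod>i\<in>I. \<integral>\<^sup>+t. ennreal (exp ((s i * t)\<^sup>2 / 2)) \<partial>std_normal)"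
    unfolding inner by (rule nn_integral_gaussian_prod[OF C I ll]) auto
  also have "\<dots> = (\<Prod>i\<in>I. if s i < 1 then ennreal (1 / sqrt (1 - (s i)\<^sup>2)) else \<infinity>)"
    by (intro prod.cong refl nn_integral_std_normal_exp_square s)
  finally have prod: "(\<integral>\<^sup>+(u, v). ennreal (exp (u \<bullet> (A *v v)))
        \<partial>(distr (joint_gaussian C) borel fst \<Otimes>\<^sub>M distr (joint_gaussian C) borel snd))
      = (\<Prod>i\<in>I. if s i < 1 then ennreal (1 / sqrt (1 - (s i)\<^sup>2)) else \<infinity>)" .
  have sq: "(s i)\<^sup>2 < 1" if "i \<in> I" "s i < 1" for i
    using s[OF that(1)] that(2) by (simp add: abs_square_less_1)
  have "ext_log (\<Prod>i\<in>I. if s i < 1 then ennreal (1 / sqrt (1 - (s i)\<^sup>2)) else \<infinity>)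
      = (if \<forall>i\<in>I. s i < 1 then ereal (\<Sum>i\<in>I. phi (s i)) else \<infinity>)"
  proof (cases "\<forall>i\<in>I. s i < 1")
    case True
    have "(\<Prod>i\<in>I. if s i < 1 then ennreal (1 / sqrt (1 - (s i)\<^sup>2)) else \<infinity>)
        = (\<Prod>i\<in>I. ennreal (1 / sqrt (1 - (s i)\<^sup>2)))"
      using True by (intro prod.cong) auto
    also have "\<dots> = ennreal (\<Prod>i\<in>I. 1 / sqrt (1 - (s i)\<^sup>2))"
      using True by (intro prod_ennreal) (auto intro: less_imp_le[OF sq])
    finally have eq: "(\<Prod>i\<in>I. if s i < 1 then ennreal (1 / sqrt (1 - (s i)\<^sup>2)) else \<infinity>)
        = ennreal (\<Prod>i\<in>I. 1 / sqrt (1 - (s i)\<^sup>2))" .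
    have pos: "0 < (\<Prod>i\<in>I. 1 / sqrt (1 - (s i)\<^sup>2))"
      using True sq by (intro prod_pos) auto
    have "ln (\<Prod>i\<in>I. 1 / sqrt (1 - (s i)\<^sup>2)) = (\<Sum>i\<in>I. ln (1 / sqrt (1 - (s i)\<^sup>2)))"
      using True by (intro ln_prod I) (auto simp: less_imp_neq[OF sq])
    also have "\<dots> = (\<Sum>i\<in>I. phi (s i))"
    proof (rule sum.cong)
      fix i assume "i \<in> I"
      with sq[of i] True show "ln (1 / sqrt (1 - (s i)\<^sup>2)) = phi (s i)"
        by (simp add: phi_def ln_div ln_sqrt)
    qed simp
    finally show ?thesis
      unfolding eq ext_log_ennreal[OF pos] using True by simp
  next
    \<comment> \<open>An infinite factor makes the product infinite because all other factors are
      nonzero.\<close>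
    case False
    then have "(\<Prod>i\<in>I. if s i < 1 then ennreal (1 / sqrt (1 - (s i)\<^sup>2)) else \<infinity>) = \<infinity>"
      using I sq by (auto simp: ennreal_prod_eq_top ennreal_eq_0_iff not_le)
    then show ?thesis using False by (simp add: ext_log_def)
  qed
  then show ?thesis
    unfolding L_joint_def P_def[symmetric] Q_def[symmetric] A_def[symmetric] expect prod
    by (simp add: sum_subtractf)
qed

subsection \<open>Lower bound and its equality case\<close>

text \<open>The equation is the stationarity condition \<open>s / (1 - s^2) = m\<close> of
  \<open>phi s - s * m\<close>, cleared of its denominator. It stands in for the closed formula of
  \<open>h\<close> from here on.\<close>

lemma h_root:
  assumes "0 \<le> m"
  shows "0 \<le> h m" "h m < 1" "m * (1 - (h m)\<^sup>2) = h m"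
proof -
  have "0 \<le> h m \<and> h m < 1 \<and> m * (1 - (h m)\<^sup>2) = h m"
  proof (cases "m = 0")
    case True
    then show ?thesis by (simp add: h_def)
  next
    case False
    then have m: "0 < m" using assms by simp
    define d where "d = sqrt (1 + 4 * m\<^sup>2)"
    have d2: "d\<^sup>2 = 1 + 4 * m\<^sup>2" by (simp add: d_def)
    have hd: "h m = (d - 1) / (2 * m)"
      using m by (simp add: h_def d_def field_simps)
    have d1: "1 \<le> d" by (simp add: d_def)
    have "(1 + 2 * m)\<^sup>2 = 1 + 4 * m\<^sup>2 + 4 * m" by (simp add: power2_eq_square algebra_simps)
    then have "d\<^sup>2 < (1 + 2 * m)\<^sup>2" using m d2 by simp
    then have "d < 1 + 2 * m" using m by (intro power2_less_imp_less[of d]) auto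
    moreover have "m * (1 - (h m)\<^sup>2) = (4 * m\<^sup>2 - (d - 1)\<^sup>2) / (4 * m)"
      using m by (simp add: hd power_divide field_simps power2_eq_square)
    moreover have "4 * m\<^sup>2 - (d - 1)\<^sup>2 = 2 * (d - 1)"
      using d2 by (simp add: power2_eq_square algebra_simps)
    moreover have "2 * (d - 1) / (4 * m) = (d - 1) / (2 * m)"
      using m by (simp add: field_simps)
    ultimately have "d < 1 + 2 * m" "m * (1 - (h m)\<^sup>2) = h m"
      using m by (simp_all add: hd)
    then show ?thesis
      using m d1 by (simp add: hd)
  qed
  then show "0 \<le> h m" "h m < 1" "m * (1 - (h m)\<^sup>2) = h m" by auto
qed

lemma h_0 [simp]: "h 0 = 0"
  by (simp add: h_def)

lemma one_minus_square_pos: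
  fixes s :: real assumes "0 \<le> s" "s < 1" shows "0 < 1 - s\<^sup>2"
  using assms by (simp add: abs_square_less_1)

text \<open>The difference of the two equations factors, and the factor other than
  \<open>h m - s\<close> is positive.\<close>

lemma h_unique:
  assumes m: "0 \<le> m" and s: "0 \<le> s" "s < 1" "m * (1 - s\<^sup>2) = s"
  shows "h m = s"
proof -
  have "(h m - s) * (m * (h m + s) + 1) = 0"
    using h_root(3)[OF m] s(3) by (simp add: power2_eq_square algebra_simps)
  moreover have "0 < m * (h m + s) + 1"
    using m s h_root(1)[OF m] by (intro add_nonneg_pos mult_nonneg_nonneg add_nonneg_nonneg) auto
  ultimately show ?thesis by simp
qed

lemma h_inverse:
  assumes "0 \<le> s" "s < 1" shows "h (s / (1 - s\<^sup>2)) = s"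
  using assms one_minus_square_pos[OF assms] by (intro h_unique) auto

lemma h_mono:
  assumes "0 \<le> m" "m \<le> m'" shows "h m \<le> h m'"
proof (rule ccontr)
  assume "\<not> h m \<le> h m'"
  then have less: "h m' < h m" by simp
  have m': "0 \<le> m'" using assms by simp
  have "(h m')\<^sup>2 \<le> (h m)\<^sup>2"
    using less h_root(1)[OF m'] by (intro power_mono) auto
  then have "m * (1 - (h m)\<^sup>2) \<le> m' * (1 - (h m')\<^sup>2)"
    using assms one_minus_square_pos[OF h_root(1,2)[OF assms(1)]] by (intro mult_mono) auto
  then show False using less h_root(3)[OF assms(1)] h_root(3)[OF m'] by simp
qed

text \<open>The minimum of \<open>phi s - s * m\<close> over \<open>0 \<le> s < 1\<close>, written
  \<open>g(m)\<close> in the overview.\<close>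

definition opt_val :: "real \<Rightarrow> real" where "opt_val m = phi (h m) - h m * m"

lemma phi_pos: "0 < s \<Longrightarrow> s < 1 \<Longrightarrow> 0 < phi s"
  using one_minus_square_pos[of s] by (simp add: phi_def)

lemma opt_val_0 [simp]: "opt_val 0 = 0"
  by (simp add: opt_val_def phi_def)

text \<open>The bound \<open>ln t \<le> t - 1\<close> at \<open>t = (1 - s^2) / (1 - a^2)\<close>
  with \<open>a = h m\<close>. The square that remains makes the minimizer unique.\<close>

lemma phi_tangent:
  assumes m: "0 \<le> m" and s: "0 \<le> s" "s < 1"
  shows "opt_val m + (s - h m)\<^sup>2 / (2 * (1 - (h m)\<^sup>2)) \<le> phi s - s * m"
proof -
  define a where "a = h m"
  have a: "0 < 1 - a\<^sup>2" "m * (1 - a\<^sup>2) = a"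
    using one_minus_square_pos h_root[OF m] by (auto simp: a_def)
  have s1: "0 < 1 - s\<^sup>2" using s by (rule one_minus_square_pos)
  have meq: "m = a / (1 - a\<^sup>2)" using a by (simp add: field_simps)
  have "ln ((1 - s\<^sup>2) / (1 - a\<^sup>2)) \<le> (1 - s\<^sup>2) / (1 - a\<^sup>2) - 1"
    using a s1 by (intro ln_le_minus_one) simp
  then have "ln (1 - s\<^sup>2) - ln (1 - a\<^sup>2) \<le> (a\<^sup>2 - s\<^sup>2) / (1 - a\<^sup>2)"
    using a s1 by (simp add: ln_div field_simps)
  then have "phi a - phi s \<le> (a\<^sup>2 - s\<^sup>2) / (1 - a\<^sup>2) / 2"
  proof -
    have aux: "- q / 2 - - p / 2 \<le> X / 2" if "p - q \<le> X" for p q X :: real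
      using that by simp
    show ?thesis unfolding phi_def by (rule aux) fact
  qed
  also have "\<dots> = a * m - s * m - (s - a)\<^sup>2 / (2 * (1 - a\<^sup>2))"
  proof -
    have "(a\<^sup>2 - s\<^sup>2) / w / 2 = a * (a / w) - s * (a / w) - (s - a)\<^sup>2 / (2 * w)" if "0 < w" for w
      using that by (simp add: field_simps power2_eq_square)
    from this[OF a(1)] show ?thesis by (simp add: meq)
  qed
  finally show ?thesis by (simp add: opt_val_def a_def)
qed

lemma phi_ge_opt_val:
  assumes "0 \<le> m" "0 \<le> s" "s < 1" shows "opt_val m \<le> phi s - s * m"
proof -
  have "0 \<le> (s - h m)\<^sup>2 / (2 * (1 - (h m)\<^sup>2))"
    using one_minus_square_pos[OF h_root(1,2)[OF assms(1)]] by simp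
  then show ?thesis using phi_tangent[OF assms] by linarith
qed

lemma phi_eq_opt_val:
  assumes "0 \<le> m" "0 \<le> s" "s < 1" "phi s - s * m = opt_val m" shows "s = h m"
proof (rule ccontr)
  assume "s \<noteq> h m"
  then have "0 < (s - h m)\<^sup>2 / (2 * (1 - (h m)\<^sup>2))"
    using one_minus_square_pos[OF h_root(1,2)[OF assms(1)]] by simp
  then show False using phi_tangent[OF assms(1-3)] assms(4) by linarith
qed

text \<open>The minimizer \<open>h m\<close> is a competitor in the problem for \<open>m'\<close>.
  It is not optimal there because \<open>h\<close> is injective, and increasing the slope to
  \<open>m'\<close> does not increase its value.\<close>

lemma opt_val_strict_antimono:
  assumes "0 \<le> m" "m < m'" shows "opt_val m' < opt_val m"
proof -
  have m': "0 \<le> m'" using assms by simp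
  have "h m \<noteq> h m'"
  proof
    assume eq: "h m = h m'"
    have "m * (1 - (h m)\<^sup>2) = m' * (1 - (h m)\<^sup>2)"
      using h_root(3)[OF assms(1)] h_root(3)[OF m'] eq by simp
    then show False
      using one_minus_square_pos[OF h_root(1,2)[OF assms(1)]] assms(2) by simp
  qed
  then have "opt_val m' < phi (h m) - h m * m'"
    using phi_ge_opt_val[OF m' h_root(1,2)[OF assms(1)]] phi_eq_opt_val[OF m' h_root(1,2)[OF assms(1)]]
    by fastforce
  also have "\<dots> \<le> opt_val m"
    using assms h_root(1)[OF assms(1)] by (simp add: opt_val_def mult_left_mono)
  finally show ?thesis .
qed

lemma opt_val_antimono: "0 \<le> m \<Longrightarrow> m \<le> m' \<Longrightarrow> opt_val m' \<le> opt_val m"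
  using opt_val_strict_antimono[of m m'] by (cases "m = m'") auto

lemma opt_val_nonpos: "0 \<le> m \<Longrightarrow> opt_val m \<le> 0"
  using opt_val_antimono[of 0 m] by simp

section \<open>Positions in the index order and a weighted-sum inequality\<close>

text \<open>Positions count from 0 and agree with the condition in \<open>diag_trunc\<close>, so
  \<open>pos j < r\<close> selects the first \<open>r\<close> indices.\<close>

definition pos :: "'k::{finite,linorder} \<Rightarrow> nat" where "pos j = card {l. l < j}"

lemma pos_strict_mono: "i < j \<Longrightarrow> pos i < pos j"
  unfolding pos_def by (intro psubset_card_mono) auto

lemma pos_mono: "i \<le> j \<Longrightarrow> pos i \<le> pos j"
  by (auto simp: le_less dest: pos_strict_mono)

lemma pos_less: "pos (j::'k::{finite,linorder}) < CARD('k)"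
  unfolding pos_def by (intro psubset_card_mono) auto

lemma bij_pos: "bij_betw pos (UNIV::'k::{finite,linorder} set) {..<CARD('k)}"
proof -
  have inj: "inj (pos :: 'k \<Rightarrow> nat)"
    by (rule injI) (metis less_irrefl linorder_neqE pos_strict_mono)
  moreover have "range (pos :: 'k \<Rightarrow> nat) \<subseteq> {..<CARD('k)}" using pos_less by auto
  then have "range (pos :: 'k \<Rightarrow> nat) = {..<CARD('k)}"
    by (intro card_subset_eq) (auto simp: card_image[OF inj])
  ultimately show ?thesis by (simp add: bij_betw_def)
qed

lemma card_pos_less:
  assumes "r \<le> CARD('k)" shows "card {j::'k::{finite,linorder}. pos j < r} = r"
proof -
  have "bij_betw pos {j::'k. pos j < r} {..<r}"
    using bij_pos[where 'k='k] assms
    by (auto simp: bij_betw_def inj_on_def image_def set_eq_iff) (metis (mono_tags) lessThan_iff less_le_trans rangeE)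
  then show ?thesis using bij_betw_same_card by fastforce
qed

text \<open>A linear program: weights at most 1 with total at most \<open>r\<close> do best by
  filling the \<open>r\<close> smallest values. Every term is compared with the threshold value
  \<open>t\<close>.\<close>

lemma sum_le_weighted_sum:
  fixes c G :: "'k::{finite,linorder} \<Rightarrow> real"
  assumes r: "0 < r" "r \<le> CARD('k)" and c: "\<And>j. 0 \<le> c j" "\<And>j. c j \<le> 1" "(\<Sum>j\<in>UNIV. c j) \<le> real r"
    and G: "\<And>j. G j \<le> 0" "\<And>i j. i \<le> j \<Longrightarrow> G i \<le> G j"
  shows "(\<Sum>j | pos j < r. G j) \<le> (\<Sum>j\<in>UNIV. c j * G j)"
proof -
  \<comment> \<open>The last index counted on the left, which exists because
    \<open>r > 0\<close>.\<close>
  obtain k :: 'k where k: "pos k = r - 1"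
    using bij_pos[where 'k='k] r by (metis (no_types, lifting) UNIV_I bij_betw_def diff_less imageE lessThan_iff less_le_trans zero_less_one)
  define t where "t = G k"
  have "c j * t - t * of_bool (pos j < r) \<le> c j * G j - G j * of_bool (pos j < r)" for j
  proof (cases "pos j < r")
    case True
    have "j \<le> k"
      by (rule ccontr) (use True k pos_strict_mono[of k j] in \<open>auto simp: not_le\<close>)
    then have "(1 - c j) * (t - G j) \<ge> 0"
      using G(2) c(2) by (intro mult_nonneg_nonneg) (auto simp: t_def)
    then show ?thesis using True by (simp add: algebra_simps)
  next
    case False
    have "k \<le> j"
      by (rule ccontr) (use False k pos_strict_mono[of j k] in \<open>auto simp: not_le\<close>)
    then have "c j * (G j - t) \<ge> 0"
      using G(2) c(1) by (intro mult_nonneg_nonneg) (auto simp: t_def)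
    then show ?thesis using False by (simp add: algebra_simps)
  qed
  then have "(\<Sum>j\<in>UNIV. c j * t - t * of_bool (pos j < r)) \<le> (\<Sum>j\<in>UNIV. c j * G j - G j * of_bool (pos j < r))"
    by (rule sum_mono)
  moreover have "(\<Sum>j\<in>(UNIV::'k set). of_bool (pos j < r)) = real r"
    using card_pos_less[OF r(2)] by (simp add: of_bool_def sum.If_cases)
  moreover have "(\<Sum>j\<in>UNIV. G j * of_bool (pos j < r)) = (\<Sum>j | pos j < r. G j)"
    by (simp add: of_bool_def if_distrib[of "\<lambda>z. _ * z"] sum.If_cases cong: if_cong)
  \<comment> \<open>A total weight below \<open>r\<close> does no harm to the bound because
    \<open>t \<le> 0\<close>.\<close>
  ultimately have "- t * (real r - (\<Sum>j\<in>UNIV. c j)) \<le> (\<Sum>j\<in>UNIV. c j * G j) - (\<Sum>j | pos j < r. G j)"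
    by (simp add: sum_subtractf right_diff_distrib mult.commute flip: sum_distrib_left sum_distrib_right)
  moreover have "0 \<le> - t * (real r - (\<Sum>j\<in>UNIV. c j))"
    using G(1) c(3) by (intro mult_nonneg_nonneg) (auto simp: t_def)
  ultimately show ?thesis by linarith
qed

section \<open>Singular value decompositions in terms of columns\<close>

lemma transpose_dyadic_sum: "transpose (dyadic_sum I s x y) = dyadic_sum I s y x"
  by (simp add: dyadic_sum_def transpose_def vec_eq_iff ac_simps)

lemma diagonal_sandwich:
  fixes D :: "real^('k::finite)^('k::_)"
  assumes "\<And>i j. i \<noteq> j \<Longrightarrow> D $ i $ j = 0"
  shows "U ** D ** transpose V = dyadic_sum UNIV (\<lambda>j. D $ j $ j) (\<lambda>j. column j U) (\<lambda>j. column j V)"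
proof -
  have "(\<Sum>i\<in>UNIV. U $ a $ i * D $ i $ j) = U $ a $ j * D $ j $ j" for a j
  proof -
    have "(\<Sum>i\<in>UNIV. U $ a $ i * D $ i $ j) = (\<Sum>i\<in>UNIV. if i = j then U $ a $ j * D $ j $ j else 0)"
      by (rule sum.cong) (auto simp: assms)
    then show ?thesis by simp
  qed
  then show ?thesis
    by (simp add: dyadic_sum_def matrix_matrix_mult_def transpose_def column_def vec_eq_iff ac_simps)
qed

lemma orthonormal_columns: "transpose U ** U = mat 1 \<longleftrightarrow> orthonormal_on UNIV (\<lambda>j. column j (U :: real^'k^'m))"
  by (simp add: orthonormal_on_def matrix_matrix_mult_def transpose_def mat_def vec_eq_iff inner_vec_def column_def)

lemma is_svd_iff:
  fixes M :: "real^'n^'m" and S :: "real^('k::{finite,linorder})^('k::_)"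
  shows "is_svd M U S V \<longleftrightarrow> CARD('k) = min CARD('m) CARD('n) \<and>
     orthonormal_on UNIV (\<lambda>j. column j U) \<and> orthonormal_on UNIV (\<lambda>j. column j V) \<and>
     (\<forall>i j. i \<noteq> j \<longrightarrow> S $ i $ j = 0) \<and> (\<forall>i. 0 \<le> S $ i $ i) \<and>
     (\<forall>i j. i \<le> j \<longrightarrow> S $ j $ j \<le> S $ i $ i) \<and>
     M = dyadic_sum UNIV (\<lambda>j. S $ j $ j) (\<lambda>j. column j U) (\<lambda>j. column j V)"
proof (cases "\<forall>i j. i \<noteq> j \<longrightarrow> S $ i $ j = 0")
  case True
  then have "U ** S ** transpose V = dyadic_sum UNIV (\<lambda>j. S $ j $ j) (\<lambda>j. column j U) (\<lambda>j. column j V)"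
    by (intro diagonal_sandwich) auto
  then show ?thesis by (simp only: is_svd_def orthonormal_columns)
next
  case False
  then show ?thesis unfolding is_svd_def by blast
qed

lemma diag_trunc_sandwich:
  "U ** diag_trunc r S ** transpose V
    = dyadic_sum {j. pos j < r} (\<lambda>j. S $ j $ j) (\<lambda>j. column j U) (\<lambda>j. column j V)"
proof -
  have "U ** diag_trunc r S ** transpose V
      = dyadic_sum UNIV (\<lambda>j. diag_trunc r S $ j $ j) (\<lambda>j. column j U) (\<lambda>j. column j V)"
    by (rule diagonal_sandwich) (simp add: diag_trunc_def)
  also have "\<dots> = dyadic_sum {j. pos j < r} (\<lambda>j. S $ j $ j) (\<lambda>j. column j U) (\<lambda>j. column j V)"
    unfolding dyadic_sum_def
    by (intro arg_cong[of _ _ vec_lambda] ext sum.mono_neutral_cong_right)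
       (auto simp: diag_trunc_def pos_def)
  finally show ?thesis .
qed

lemma dyadic_sum_eqI: "(\<And>z. M *v z = (\<Sum>i\<in>I. (s i * (y i \<bullet> z)) *\<^sub>R x i)) \<Longrightarrow> M = dyadic_sum I s x y"
  by (simp add: matrix_eq dyadic_sum_mult)

lemma inner_dyadic_sum_mult:
  assumes "orthonormal_on I x" "finite I" "j \<in> I"
  shows "x j \<bullet> (dyadic_sum I s x y *v z) = s j * (y j \<bullet> z)"
  unfolding dyadic_sum_mult by (rule inner_sum_orthonormal[OF assms])

lemma dyadic_sum_mult_basis:
  assumes "orthonormal_on I y" "finite I" "j \<in> I"
  shows "dyadic_sum I s x y *v y j = s j *\<^sub>R x j"
proof -
  have "dyadic_sum I s x y *v y j = (\<Sum>i\<in>I. if i = j then s j *\<^sub>R x j else 0)"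
    unfolding dyadic_sum_mult
    by (rule sum.cong) (auto simp: orthonormal_onD[OF assms(1) _ assms(3)])
  then show ?thesis using assms by simp
qed

text \<open>The loss splits into the sum of the terms \<open>d i\<close>, which are nonnegative, and a sum weighted by the
  doubly substochastic \<open>p\<close>. Unlike in the usual proof of von Neumann's trace inequality,
  the equality case can be read off from \<open>d i = 0\<close>, ties between singular values included.\<close>

context
  fixes m :: "'k::{finite,linorder} \<Rightarrow> real" and u :: "'k \<Rightarrow> real^'m" and v :: "'k \<Rightarrow> real^'n"
    and E :: "'i set" and s :: "'i \<Rightarrow> real" and x :: "'i \<Rightarrow> real^'m" and y :: "'i \<Rightarrow> real^'n" and r :: nat
  assumes u: "orthonormal_on UNIV u" and v: "orthonormal_on UNIV v"
    and m: "\<And>j. 0 \<le> m j" "\<And>i j. i \<le> j \<Longrightarrow> m j \<le> m i"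
    and E: "finite E" "card E \<le> r" and r: "0 < r" "r \<le> CARD('k)"
    and x: "orthonormal_on E x" and y: "orthonormal_on E y"
    and s: "\<And>i. i \<in> E \<Longrightarrow> 0 < s i" "\<And>i. i \<in> E \<Longrightarrow> s i < 1"
begin

private definition "p i j = ((u j \<bullet> x i)\<^sup>2 + (v j \<bullet> y i)\<^sup>2) / 2"

text \<open>The identity \<open>2ab = a^2 + b^2 - (a - b)^2\<close>, for
  \<open>a = u j \<bullet> x i\<close> and \<open>b = v j \<bullet> y i\<close>, splits the bilinear
  term into a weight \<open>p i j\<close> and a square. The second summand is the weighted excess
  over the scalar minimum.\<close>

private definition "e i j = s i * m j * (u j \<bullet> x i - v j \<bullet> y i)\<^sup>2 / 2
  + p i j * (phi (s i) - s i * m j - opt_val (m j))"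

text \<open>The last summand accounts for the part of \<open>phi (s i)\<close> that the row sum of
  \<open>p\<close>, possibly below 1, leaves over.\<close>

private definition "d i = (\<Sum>j\<in>UNIV. e i j) + (1 - (\<Sum>j\<in>UNIV. p i j)) * phi (s i)"

private lemma p_nonneg: "0 \<le> p i j"
  by (simp add: p_def)

private lemma p_row: "i \<in> E \<Longrightarrow> (\<Sum>j\<in>UNIV. p i j) \<le> 1"
  using bessel[OF u, of "x i"] bessel[OF v, of "y i"] x y
  by (simp add: p_def sum.distrib orthonormal_onD flip: sum_divide_distrib)

private lemma p_col: "(\<Sum>i\<in>E. p i j) \<le> 1"
  using bessel[OF x E(1), of "u j"] bessel[OF y E(1), of "v j"] u v
  by (simp add: p_def sum.distrib orthonormal_onD inner_commute flip: sum_divide_distrib)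

private lemma e_parts:
  assumes "i \<in> E"
  shows "0 \<le> s i * m j * (u j \<bullet> x i - v j \<bullet> y i)\<^sup>2 / 2"
    "0 \<le> p i j * (phi (s i) - s i * m j - opt_val (m j))"
  using s[OF assms] m(1)[of j] p_nonneg[of i j] phi_ge_opt_val[OF m(1), of "s i" j] by auto

private lemma e_nonneg: "i \<in> E \<Longrightarrow> 0 \<le> e i j"
  using e_parts[of i j] by (simp add: e_def)

private lemma d_nonneg: "i \<in> E \<Longrightarrow> 0 \<le> d i"
  unfolding d_def using e_nonneg p_row phi_pos[OF s]
  by (intro add_nonneg_nonneg sum_nonneg mult_nonneg_nonneg) (auto simp: less_imp_le)

private lemma value_split:
  "(\<Sum>i\<in>E. phi (s i) - s i * (x i \<bullet> (dyadic_sum UNIV m u v *v y i)))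
    = (\<Sum>i\<in>E. d i) + (\<Sum>j\<in>UNIV. (\<Sum>i\<in>E. p i j) * opt_val (m j))"
proof -
  have "phi (s i) - s i * (x i \<bullet> (dyadic_sum UNIV m u v *v y i)) = d i + (\<Sum>j\<in>UNIV. p i j * opt_val (m j))" for i
  proof -
    have e: "e i j = p i j * phi (s i) - s i * (m j * (u j \<bullet> x i) * (v j \<bullet> y i)) - p i j * opt_val (m j)" for j
      by (simp add: e_def p_def power2_eq_square field_simps)
    have "x i \<bullet> (dyadic_sum UNIV m u v *v y i) = (\<Sum>j\<in>UNIV. m j * (u j \<bullet> x i) * (v j \<bullet> y i))"
      by (simp add: dyadic_sum_mult inner_sum_right inner_commute[of "x i"] ac_simps)
    then show ?thesis
      by (simp add: d_def e sum_subtractf left_diff_distrib sum_distrib_left sum_distrib_right)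
  qed
  then have "(\<Sum>i\<in>E. phi (s i) - s i * (x i \<bullet> (dyadic_sum UNIV m u v *v y i)))
      = (\<Sum>i\<in>E. d i) + (\<Sum>i\<in>E. \<Sum>j\<in>UNIV. p i j * opt_val (m j))"
    by (simp add: sum.distrib)
  also have "(\<Sum>i\<in>E. \<Sum>j\<in>UNIV. p i j * opt_val (m j)) = (\<Sum>j\<in>UNIV. (\<Sum>i\<in>E. p i j) * opt_val (m j))"
    by (subst sum.swap) (simp add: sum_distrib_right)
  finally show ?thesis .
qed

text \<open>The column sums of \<open>p\<close> are admissible weights: each is at most 1, and by
  the row bounds they total at most \<open>card E \<le> r\<close>.\<close>

private lemma weighted_bound:
  "(\<Sum>j | pos j < r. opt_val (m j)) \<le> (\<Sum>j\<in>UNIV. (\<Sum>i\<in>E. p i j) * opt_val (m j))"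
proof (rule sum_le_weighted_sum[OF r])
  have "(\<Sum>j\<in>UNIV. \<Sum>i\<in>E. p i j) = (\<Sum>i\<in>E. \<Sum>j\<in>UNIV. p i j)"
    by (rule sum.swap)
  also have "\<dots> \<le> (\<Sum>i\<in>E. 1)" by (intro sum_mono p_row)
  finally show "(\<Sum>j\<in>UNIV. \<Sum>i\<in>E. p i j) \<le> real r" using E(2) by simp
qed (auto intro: sum_nonneg p_nonneg p_col opt_val_nonpos opt_val_antimono m)

lemma loss_lower_bound:
  "(\<Sum>j | pos j < r. opt_val (m j)) \<le> (\<Sum>i\<in>E. phi (s i) - s i * (x i \<bullet> (dyadic_sum UNIV m u v *v y i)))"
  using value_split weighted_bound sum_nonneg[of E d] d_nonneg by fastforce

text \<open>Equality forces \<open>d i = 0\<close>, hence every \<open>e i j = 0\<close> and row sum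
  1. If \<open>p i j = 0\<close>, both coordinates vanish; otherwise the scalar equality case gives
  \<open>s i = h (m j)\<close>, and the square term makes the coordinates equal.\<close>

lemma loss_lower_bound_eq:
  assumes eq: "(\<Sum>i\<in>E. phi (s i) - s i * (x i \<bullet> (dyadic_sum UNIV m u v *v y i))) = (\<Sum>j | pos j < r. opt_val (m j))"
    and i: "i \<in> E"
  shows "u j \<bullet> x i = v j \<bullet> y i" "h (m j) * (u j \<bullet> x i) = s i * (u j \<bullet> x i)"
    "x i = (\<Sum>j\<in>UNIV. (u j \<bullet> x i) *\<^sub>R u j)" "y i = (\<Sum>j\<in>UNIV. (v j \<bullet> y i) *\<^sub>R v j)"
proof -
  have "(\<Sum>i\<in>E. d i) \<le> 0" using value_split weighted_bound eq by linarith
  then have "(\<Sum>i\<in>E. d i) = 0" using d_nonneg by (intro antisym sum_nonneg) auto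
  then have d0: "d i = 0" using sum_nonneg_eq_0_iff[OF E(1), of d] d_nonneg i by auto
  have phi: "0 < phi (s i)" using phi_pos s i by auto
  have ge: "0 \<le> (\<Sum>j\<in>UNIV. e i j)" "0 \<le> (1 - (\<Sum>j\<in>UNIV. p i j)) * phi (s i)"
    using e_nonneg[OF i] p_row[OF i] phi by (auto intro: sum_nonneg)
  have "(\<Sum>j\<in>UNIV. e i j) = 0" and row: "(\<Sum>j\<in>UNIV. p i j) = 1"
    using d0 ge phi by (auto simp: d_def add_nonneg_eq_0_iff)
  then have e0: "e i j = 0" for j
    using sum_nonneg_eq_0_iff[of UNIV "e i"] e_nonneg[OF i] by auto
  have both: "u j \<bullet> x i = v j \<bullet> y i \<and> h (m j) * (u j \<bullet> x i) = s i * (u j \<bullet> x i)" for j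
  proof (cases "p i j = 0")
    case True
    then show ?thesis by (simp add: p_def add_nonneg_eq_0_iff)
  next
    case False
    have parts: "s i * m j * (u j \<bullet> x i - v j \<bullet> y i)\<^sup>2 / 2 = 0"
      "p i j * (phi (s i) - s i * m j - opt_val (m j)) = 0"
      using e0[of j] e_parts[OF i, of j] by (auto simp: e_def add_nonneg_eq_0_iff)
    then have "s i = h (m j)"
      using False s[OF i] m(1) by (intro phi_eq_opt_val) auto
    \<comment> \<open>If \<open>m j\<close> were 0, then \<open>s i = h 0 = 0\<close>, against
      \<open>s i > 0\<close>.\<close>
    moreover then have "m j \<noteq> 0" using s(1)[OF i] by auto
    ultimately show ?thesis using parts(1) s(1)[OF i] by simp
  qed
  from both[of j] show "u j \<bullet> x i = v j \<bullet> y i" "h (m j) * (u j \<bullet> x i) = s i * (u j \<bullet> x i)" by auto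
  \<comment> \<open>The row sum averages two sums of squares that are now known to agree, so both
    Bessel inequalities are equalities.\<close>
  have "(\<Sum>j\<in>UNIV. (u j \<bullet> x i)\<^sup>2) = 1" "(\<Sum>j\<in>UNIV. (v j \<bullet> y i)\<^sup>2) = 1"
    using row both by (simp_all add: p_def)
  then show "x i = (\<Sum>j\<in>UNIV. (u j \<bullet> x i) *\<^sub>R u j)" "y i = (\<Sum>j\<in>UNIV. (v j \<bullet> y i) *\<^sub>R v j)"
    using x y i by (auto intro!: bessel_eq u v simp: orthonormal_onD)
qed

end

section \<open>Recovering a decomposition of the whitened matrix from one of its image under
  \<open>h\<close>\<close>

text \<open>The scalar relation read along each pair of singular vectors. The resulting identity
  \<open>M - M N^T N = N\<close> mentions no particular singular vectors and can therefore be used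
  with different decompositions of \<open>N\<close>.\<close>

lemma resolvent_dyadic_sum:
  assumes u: "orthonormal_on I u" and v: "orthonormal_on I v" and I: "finite I"
    and mt: "\<And>j. j \<in> I \<Longrightarrow> m j * (1 - (t j)\<^sup>2) = t j"
  shows "dyadic_sum I m u v *v z - dyadic_sum I m u v *v (transpose (dyadic_sum I t u v) *v (dyadic_sum I t u v *v z))
    = dyadic_sum I t u v *v z"
proof -
  have "transpose (dyadic_sum I t u v) *v (dyadic_sum I t u v *v z) = (\<Sum>j\<in>I. (t j * (t j * (v j \<bullet> z))) *\<^sub>R v j)"
    unfolding transpose_dyadic_sum dyadic_sum_mult[of I t v u]
    by (rule sum.cong) (simp_all add: inner_dyadic_sum_mult[OF u I])
  then have "dyadic_sum I m u v *v (transpose (dyadic_sum I t u v) *v (dyadic_sum I t u v *v z))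
      = (\<Sum>j\<in>I. (m j * (t j * (t j * (v j \<bullet> z)))) *\<^sub>R u j)"
    unfolding dyadic_sum_mult[of I m u v] by (intro sum.cong) (simp_all add: inner_sum_orthonormal[OF v I])
  moreover have "(\<Sum>j\<in>I. (m j * (v j \<bullet> z)) *\<^sub>R u j) - (\<Sum>j\<in>I. (m j * (t j * (t j * (v j \<bullet> z)))) *\<^sub>R u j)
      = (\<Sum>j\<in>I. (t j * (v j \<bullet> z)) *\<^sub>R u j)"
    unfolding sum_subtractf[symmetric]
  proof (intro sum.cong refl)
    fix j assume "j \<in> I"
    have "m j * (v j \<bullet> z) - m j * (t j * (t j * (v j \<bullet> z))) = (m j * (1 - (t j)\<^sup>2)) * (v j \<bullet> z)"
      by (simp add: power2_eq_square algebra_simps)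
    then show "(m j * (v j \<bullet> z)) *\<^sub>R u j - (m j * (t j * (t j * (v j \<bullet> z)))) *\<^sub>R u j = (t j * (v j \<bullet> z)) *\<^sub>R u j"
      by (simp add: mt[OF \<open>j \<in> I\<close>] flip: scaleR_left_diff_distrib)
  qed
  ultimately show ?thesis
    by (simp only: dyadic_sum_mult[of I m u v z] dyadic_sum_mult[of I t u v z])
qed

text \<open>Both candidates for \<open>M\<close> solve \<open>X - X N^T N = N\<close>, so their
  difference \<open>D\<close> satisfies \<open>D = D N^T N\<close>. Since the singular values of
  \<open>N\<close> are below 1, this forces \<open>D = 0\<close>.\<close>

lemma svd_transfer:
  fixes u u' :: "'k::finite \<Rightarrow> real^'m" and v v' :: "'k \<Rightarrow> real^'n"
  assumes u: "orthonormal_on UNIV u" and v: "orthonormal_on UNIV v"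
    and u': "orthonormal_on UNIV u'" and v': "orthonormal_on UNIV v'"
    and m: "\<And>j. 0 \<le> m j" and t: "\<And>j. 0 \<le> t j"
    and N: "dyadic_sum UNIV (\<lambda>j. h (m j)) u v = dyadic_sum UNIV t u' v'"
  shows "t j < 1" "dyadic_sum UNIV m u v = dyadic_sum UNIV (\<lambda>j. t j / (1 - (t j)\<^sup>2)) u' v'"
proof -
  define N where "N = dyadic_sum UNIV (\<lambda>j. h (m j)) u v"
  have N': "N = dyadic_sum UNIV t u' v'" by (simp add: N_def assms)
  show t1: "t j < 1" for j
  proof (cases "t j = 0")
    case False
    have Nv: "N *v v' j = t j *\<^sub>R u' j"
      unfolding N' by (rule dyadic_sum_mult_basis[OF v']) auto
    have Nu: "transpose N *v u' j = t j *\<^sub>R v' j"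
      unfolding N' transpose_dyadic_sum by (rule dyadic_sum_mult_basis[OF u']) auto
    have 1: "h (m l) * (v l \<bullet> v' j) = t j * (u l \<bullet> u' j)" for l
      using inner_dyadic_sum_mult[OF u, of l "\<lambda>j. h (m j)" v "v' j"] Nv
      by (simp add: N_def[symmetric])
    have 2: "h (m l) * (u l \<bullet> u' j) = t j * (v l \<bullet> v' j)" for l
      using inner_dyadic_sum_mult[OF v, of l "\<lambda>j. h (m j)" u "u' j"] Nu
      by (simp add: N_def transpose_dyadic_sum)
    \<comment> \<open>A nonzero \<open>t j\<close> has \<open>N *v v' j\<close> nonzero, so
      \<open>v' j\<close> overlaps some \<open>v l\<close>; applying \<open>N\<close> and its
      transpose then identifies \<open>t j\<close> with \<open>h (m l)\<close>.\<close>
    have "\<exists>l. v l \<bullet> v' j \<noteq> 0"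
    proof (rule ccontr)
      assume "\<nexists>l. v l \<bullet> v' j \<noteq> 0"
      then have "N *v v' j = 0" by (simp add: N_def dyadic_sum_mult)
      then show False using Nv False orthonormal_on_nonzero[OF u', of j] by simp
    qed
    then obtain l where l: "v l \<bullet> v' j \<noteq> 0" by blast
    have "h (m l) * (h (m l) * (v l \<bullet> v' j)) = t j * (t j * (v l \<bullet> v' j))"
      using 1[of l] 2[of l] by (simp add: mult.left_commute[of "h (m l)" "t j"])
    then have "(h (m l))\<^sup>2 = (t j)\<^sup>2"
      using l by (simp add: power2_eq_square flip: mult.assoc)
    then have "h (m l) = t j"
      using power2_eq_imp_eq[OF _ h_root(1)[OF m] t] by blast
    then show ?thesis using h_root(2)[OF m, of l] by simp
  qed simp
  define M' where "M' = dyadic_sum UNIV (\<lambda>j. t j / (1 - (t j)\<^sup>2)) u' v'"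
  define D where "D = dyadic_sum UNIV m u v - M'"
  have D: "D *v z = D *v (transpose N *v (N *v z))" for z
  proof -
    have "dyadic_sum UNIV m u v *v z - dyadic_sum UNIV m u v *v (transpose N *v (N *v z)) = N *v z"
      unfolding N_def by (rule resolvent_dyadic_sum[OF u v]) (auto simp: h_root(3)[OF m])
    moreover have "M' *v z - M' *v (transpose N *v (N *v z)) = N *v z"
      unfolding N' M'_def
      by (rule resolvent_dyadic_sum[OF u' v']) (use one_minus_square_pos[OF t t1] in \<open>auto simp: less_le\<close>)
    ultimately show ?thesis
      by (simp add: D_def matrix_vector_mult_diff_rdistrib algebra_simps)
  qed
  have NN: "transpose N *v (N *v z) = (\<Sum>j\<in>UNIV. (h (m j) * (h (m j) * (v j \<bullet> z))) *\<^sub>R v j)" for z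
    unfolding N_def transpose_dyadic_sum dyadic_sum_mult[of UNIV _ v u]
    by (simp add: inner_dyadic_sum_mult[OF u])
  have Dv: "D *v v j = 0" for j
  proof -
    have "transpose N *v (N *v v j) = (h (m j))\<^sup>2 *\<^sub>R v j"
      unfolding N_def transpose_dyadic_sum
      by (simp add: dyadic_sum_mult_basis[OF v] dyadic_sum_mult_basis[OF u] matrix_vector_mult_scaleR power2_eq_square)
    then have "(1 - (h (m j))\<^sup>2) *\<^sub>R (D *v v j) = 0"
      using D[of "v j"] by (simp add: matrix_vector_mult_scaleR scaleR_left_diff_distrib)
    then show ?thesis using one_minus_square_pos[OF h_root(1,2)[OF m[of j]]] by simp
  qed
  \<comment> \<open>By \<open>D\<close> and \<open>NN\<close>, the vector \<open>D *v z\<close> is a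
    combination of the vectors \<open>D *v v j\<close>, which are zero.\<close>
  have "D *v z = 0" for z
    by (subst D, subst NN) (simp add: linear_sum[OF matrix_vector_mul_linear] matrix_vector_mult_scaleR Dv)
  then have "D = 0" by (simp add: matrix_eq)
  then show "dyadic_sum UNIV m u v = dyadic_sum UNIV (\<lambda>j. t j / (1 - (t j)\<^sup>2)) u' v'"
    by (simp add: D_def M'_def)
qed

text \<open>\<open>X\<close> and its complement are sorted separately and concatenated. Sorting all
  of \<open>B\<close> at once could mix the two sets when values of \<open>l\<close> tie.\<close>

lemma sorted_enumeration:
  fixes l :: "'a \<Rightarrow> real"
  assumes B: "finite B" "card B = CARD('k::{finite,linorder})" and X: "X \<subseteq> B"
    and l: "\<And>b b'. b \<in> X \<Longrightarrow> b' \<in> B - X \<Longrightarrow> l b' \<le> l b"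
  obtains b :: "'k::{finite,linorder} \<Rightarrow> 'a" where "bij_betw b UNIV B" "\<And>i j. i \<le> j \<Longrightarrow> l (b j) \<le> l (b i)"
    "\<And>i. b i \<in> X \<longleftrightarrow> pos i < card X"
proof -
  have fX: "finite X" using X B finite_subset by blast
  obtain xs where xs: "set xs = X" "distinct xs" using finite_distinct_list[OF fX] by blast
  obtain ys where ys: "set ys = B - X" "distinct ys" using finite_distinct_list[of "B - X"] B by blast
  define zs where "zs = sort_key (\<lambda>b. - l b) xs @ sort_key (\<lambda>b. - l b) ys"
  have zs: "set zs = B" "distinct zs"
    using xs ys X by (auto simp: zs_def)
  have len: "length zs = CARD('k)" using distinct_card[OF zs(2)] zs(1) B by simp
  have lenx: "length xs = card X" using distinct_card[OF xs(2)] xs(1) by simp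
  have sorted: "sorted (map (\<lambda>b. - l b) zs)"
    using xs ys l by (auto simp: zs_def sorted_append)
  define b where "b i = zs ! pos i" for i :: 'k
  have "bij_betw ((!) zs) {..<length zs} B"
    using zs by (intro bij_betw_nth) auto
  then have bij: "bij_betw b UNIV B"
    using bij_betw_trans[OF bij_pos[where 'k='k]] by (simp add: len b_def[abs_def] comp_def)
  have "l (b j) \<le> l (b i)" if "i \<le> j" for i j
    using sorted_nth_mono[OF sorted pos_mono[OF that]] pos_less[of j] pos_less[of i] by (simp add: b_def len)
  moreover have "b i \<in> X \<longleftrightarrow> pos i < card X" for i
  proof (cases "pos i < card X")
    case True
    then have "b i \<in> set (sort_key (\<lambda>b. - l b) xs)"
      by (auto simp: b_def zs_def nth_append lenx simp del: set_sort)
    then show ?thesis using True xs by simp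
  next
    case False
    then have "b i \<in> set (sort_key (\<lambda>b. - l b) ys)"
      using pos_less[of i] len by (auto simp: b_def zs_def nth_append lenx simp del: set_sort)
    then show ?thesis using False ys by simp
  qed
  ultimately show ?thesis using that bij by blast
qed

subsection \<open>Minimizers\<close>

lemma is_rank_truncation_iff:
  fixes N :: "real^'n^'m"
  shows "is_rank_truncation TYPE('k::{finite,linorder}) r N T \<longleftrightarrow> CARD('k) = min CARD('m) CARD('n) \<and>
    (\<exists>(t :: 'k \<Rightarrow> real) u v. orthonormal_on UNIV u \<and> orthonormal_on UNIV v \<and> (\<forall>j. 0 \<le> t j) \<and>
      (\<forall>i j. i \<le> j \<longrightarrow> t j \<le> t i) \<and> N = dyadic_sum UNIV t u v \<and> T = dyadic_sum {j. pos j < r} t u v)"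
    (is "?L \<longleftrightarrow> ?R")
proof
  assume ?L
  then obtain U :: "real^('k::_)^'m" and S and V :: "real^('k::_)^'n" where *: "is_svd N U S V"
    "T = U ** diag_trunc r S ** transpose V"
    unfolding is_rank_truncation_def by blast
  then show ?R
    unfolding is_svd_iff diag_trunc_sandwich
    by (intro conjI exI[of _ "\<lambda>j. S $ j $ j"] exI[of _ "\<lambda>j. column j U"] exI[of _ "\<lambda>j. column j V"]) simp_all
next
  assume ?R
  then obtain t :: "'k \<Rightarrow> real" and u v where *: "CARD('k) = min CARD('m) CARD('n)"
      "orthonormal_on UNIV u" "orthonormal_on UNIV v" "\<And>j. 0 \<le> t j"
      "\<And>i j. i \<le> j \<Longrightarrow> t j \<le> t i" "N = dyadic_sum UNIV t u v" "T = dyadic_sum {j. pos j < r} t u v"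
    by blast
  define U :: "real^('k::_)^'m" where "U = (\<chi> a j. u j $ a)"
  define V :: "real^('k::_)^'n" where "V = (\<chi> a j. v j $ a)"
  define S :: "real^('k::_)^('k::_)" where "S = (\<chi> i j. if i = j then t i else 0)"
  have "column j U = u j" "column j V = v j" "S $ j $ j = t j" for j
    by (simp_all add: U_def V_def S_def column_def vec_eq_iff)
  then have "is_svd N U S V \<and> T = U ** diag_trunc r S ** transpose V"
    unfolding is_svd_iff diag_trunc_sandwich using * by (simp add: S_def)
  then show ?L unfolding is_rank_truncation_def by blast
qed

section \<open>From the equality case to a truncation\<close>

text \<open>An isometry when \<open>u\<close> is orthonormal. One coordinate vector \<open>a\<close>
  thus yields a left vector \<open>synth u a\<close> and a matching right vector
  \<open>synth v a\<close>.\<close>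

definition synth :: "('k::finite \<Rightarrow> real^'m) \<Rightarrow> real^'k \<Rightarrow> real^'m" where
  "synth u a = (\<Sum>j\<in>UNIV. a $ j *\<^sub>R u j)"

lemma linear_synth: "linear (synth u)"
  by (rule linearI) (simp_all add: synth_def scaleR_left_distrib sum.distrib scaleR_sum_right)

lemma inner_synth: "orthonormal_on UNIV u \<Longrightarrow> synth u a \<bullet> synth u b = a \<bullet> b"
  unfolding synth_def by (simp only: norm_sum_orthonormal finite_class.finite_UNIV) (simp add: inner_vec_def)

lemma orthonormal_on_synth:
  "orthonormal_on UNIV u \<Longrightarrow> orthonormal_on B (\<lambda>b. b) \<Longrightarrow> orthonormal_on B (synth u)"
  by (simp add: orthonormal_on_def inner_synth)

text \<open>By \<open>coord\<close>, \<open>x i\<close> and \<open>y i\<close> share a coordinate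
  vector \<open>w i\<close>, an eigenvector of the diagonal matrix \<open>H\<close> of the
  \<open>h (m j)\<close>. The \<open>w i\<close> extend to an eigenbasis, whose images under
  \<open>synth\<close> decompose \<open>N\<close>; minimality shows that the \<open>w i\<close>
  carry the largest eigenvalues. Competitors are indexed by coordinate vectors because subsets of
  the eigenbasis serve as index sets.\<close>

lemma rank_truncation_of_eigenvectors:
  fixes u :: "'k::{finite,linorder} \<Rightarrow> real^'m" and v :: "'k \<Rightarrow> real^'n" and m :: "'k \<Rightarrow> real"
  assumes card: "CARD('k) = min CARD('m) CARD('n)"
    and u: "orthonormal_on UNIV u" and v: "orthonormal_on UNIV v" and m: "\<And>j. 0 \<le> m j"
    and x: "orthonormal_on E x" and E: "finite E" "card E \<le> r"
    and coord: "\<And>i j. i \<in> E \<Longrightarrow> u j \<bullet> x i = v j \<bullet> y i"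
      "\<And>i j. i \<in> E \<Longrightarrow> h (m j) * (u j \<bullet> x i) = s i * (u j \<bullet> x i)"
      "\<And>i. i \<in> E \<Longrightarrow> x i = (\<Sum>j\<in>UNIV. (u j \<bullet> x i) *\<^sub>R u j)"
      "\<And>i. i \<in> E \<Longrightarrow> y i = (\<Sum>j\<in>UNIV. (v j \<bullet> y i) *\<^sub>R v j)"
    and minimal: "\<And>(J :: (real^('k::_)) set) l a b. finite J \<Longrightarrow> card J \<le> r \<Longrightarrow> orthonormal_on J a \<Longrightarrow>
      orthonormal_on J b \<Longrightarrow> (\<And>i. i \<in> J \<Longrightarrow> 0 \<le> l i \<and> l i < 1) \<Longrightarrow>
      (\<Sum>i\<in>E. phi (s i) - s i * (x i \<bullet> (dyadic_sum UNIV m u v *v y i)))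
      \<le> (\<Sum>i\<in>J. phi (l i) - l i * (a i \<bullet> (dyadic_sum UNIV m u v *v b i)))"
  shows "is_rank_truncation TYPE('k) r (dyadic_sum UNIV (\<lambda>j. h (m j)) u v) (dyadic_sum E s x y)"
proof -
  define H :: "real^('k::_)^('k::_)" where "H = (\<chi> i j. if i = j then h (m i) else 0)"
  have H: "(H *v a) $ j = h (m j) * a $ j" for a j
    by (simp add: H_def matrix_vector_mult_def if_distrib[of "\<lambda>z. z * _"] cong: if_cong)
  have symH: "transpose H = H" by (simp add: H_def transpose_def vec_eq_iff)
  define w where "w i = (\<chi> j. u j \<bullet> x i)" for i
  have xw: "synth u (w i) = x i" if "i \<in> E" for i
    using coord(3)[OF that] by (simp add: synth_def w_def)
  have yw: "synth v (w i) = y i" if "i \<in> E" for i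
    using coord(4)[OF that] by (simp add: synth_def w_def coord(1)[OF that])
  have "orthonormal_on E w"
    unfolding orthonormal_on_def
  proof (intro ballI)
    fix i j assume "i \<in> E" "j \<in> E"
    then have "w i \<bullet> w j = x i \<bullet> x j" by (simp add: inner_synth[OF u, symmetric] xw)
    then show "w i \<bullet> w j = (if i = j then 1 else 0)"
      using x \<open>i \<in> E\<close> \<open>j \<in> E\<close> by (simp add: orthonormal_onD)
  qed
  note wo = this and winj = orthonormal_on_inj[OF this]
  have Hw: "H *v w i = s i *\<^sub>R w i" if "i \<in> E" for i
    using coord(2)[OF that] by (simp add: vec_eq_iff H w_def)
  have ww: "w i \<bullet> w i = 1" if "i \<in> E" for i
    using wo that by (simp add: orthonormal_onD)
  define X where "X = w ` E"
  have "orthonormal_on X (\<lambda>b. b)"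
    using wo winj by (auto simp: X_def orthonormal_on_def inj_on_eq_iff)
  moreover have "H *v b = (b \<bullet> (H *v b)) *\<^sub>R b" if "b \<in> X" for b
    using that Hw ww by (auto simp: X_def)
  ultimately have "\<exists>B. X \<subseteq> B \<and> orthonormal_on B (\<lambda>b. b) \<and> (\<forall>b\<in>B. H *v b = (b \<bullet> (H *v b)) *\<^sub>R b) \<and> card B = DIM(real^('k::_))"
    by (intro eigenbasis_extension) (auto simp: symmetric_inner[OF symH])
  then obtain B where B: "X \<subseteq> B" "orthonormal_on B (\<lambda>b. b)" "\<And>b. b \<in> B \<Longrightarrow> H *v b = (b \<bullet> (H *v b)) *\<^sub>R b"
      "card B = CARD('k)"
    by auto
  note fB = orthonormal_on_dim(1)[OF B(2)]
  have fX: "finite X" and cX: "card X = card E" using E(1) winj by (auto simp: X_def card_image)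
  define l where "l b = b \<bullet> (H *v b)" for b
  \<comment> \<open>The preimage of the eigenvalue \<open>l b\<close> under \<open>h\<close>; it
    turns out to be the singular value of the original matrix that belongs to
    \<open>b\<close>.\<close>
  define \<mu> where "\<mu> b = l b / (1 - (l b)\<^sup>2)" for b
  have lw: "l (w i) = s i" if "i \<in> E" for i
    by (simp add: l_def Hw[OF that] ww[OF that])
  have comp: "h (m j) * b $ j = l b * b $ j" if "b \<in> B" for b j
    using arg_cong[OF B(3)[OF that], of "\<lambda>z. z $ j"] by (simp add: H l_def)
  have l01: "0 \<le> l b \<and> l b < 1" if "b \<in> B" for b
  proof -
    obtain j where j: "b $ j \<noteq> 0"
      using orthonormal_on_nonzero[OF B(2) \<open>b \<in> B\<close>] by (auto simp: vec_eq_iff)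
    have "l b = h (m j)" using comp[OF \<open>b \<in> B\<close>, of j] j by simp
    then show ?thesis using h_root[OF m] by simp
  qed
  have mu: "0 \<le> \<mu> b" "h (\<mu> b) = l b" if "b \<in> B" for b
    using l01[OF that] one_minus_square_pos[of "l b"] h_inverse[of "l b"] by (auto simp: \<mu>_def)
  \<comment> \<open>All indices in the support of \<open>b\<close> have
    \<open>h (m j) = l b\<close>, which determines \<open>m j\<close>.\<close>
  have mb: "m j * b $ j = \<mu> b * b $ j" if "b \<in> B" for b j
  proof (cases "b $ j = 0")
    case False
    then have "h (m j) = l b" using comp[OF that, of j] by simp
    then have "m j * (1 - (l b)\<^sup>2) = l b" using h_root(3)[OF m, of j] by simp
    then have "m j = \<mu> b"
      using one_minus_square_pos[of "l b"] l01[OF that] by (simp add: \<mu>_def field_simps)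
    then show ?thesis by simp
  qed simp
  have vb: "v j \<bullet> synth v b = b $ j" for b j
    unfolding synth_def by (rule inner_sum_orthonormal[OF v]) auto
  have Mb: "synth u b \<bullet> (dyadic_sum UNIV m u v *v synth v b) = \<mu> b" if b: "b \<in> B" for b
  proof -
    have "dyadic_sum UNIV m u v *v synth v b = \<mu> b *\<^sub>R synth u b"
      by (simp add: dyadic_sum_mult vb mb[OF b] synth_def[of u] scaleR_sum_right)
    moreover have "b \<bullet> b = 1" using orthonormal_onD[OF B(2) b b] by simp
    ultimately show ?thesis by (simp add: inner_synth[OF u])
  qed
  have val: "(\<Sum>b\<in>J. phi (l b) - l b * (synth u b \<bullet> (dyadic_sum UNIV m u v *v synth v b))) = (\<Sum>b\<in>J. opt_val (\<mu> b))"
    if "J \<subseteq> B" for J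
    using that by (intro sum.cong) (auto simp: Mb opt_val_def mu)
  have "(\<Sum>i\<in>E. phi (s i) - s i * (x i \<bullet> (dyadic_sum UNIV m u v *v y i))) = (\<Sum>b\<in>X. opt_val (\<mu> b))"
    unfolding val[OF B(1), symmetric] unfolding X_def sum.reindex[OF winj]
    by (rule sum.cong) (simp_all add: lw xw yw)
  then have min: "(\<Sum>b\<in>X. opt_val (\<mu> b)) \<le> (\<Sum>b\<in>J. opt_val (\<mu> b))" if "J \<subseteq> B" "card J \<le> r" for J
    using minimal[of J "synth u" "synth v" l] that fB l01 B(2) u v
    by (auto simp: val orthonormal_on_synth finite_subset orthonormal_on_subset[OF B(2)] subset_iff)
  \<comment> \<open>Exchange argument: replacing \<open>b\<close> by \<open>b'\<close> keeps the
    number of terms, so it cannot lower the value.\<close>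
  have swap: "l b' \<le> l b" if b: "b \<in> X" and b': "b' \<in> B - X" for b b'
  proof -
    have bB: "b \<in> B" "b' \<in> B" using b b' B(1) by auto
    have "card (insert b' (X - {b})) = card X"
      using b b' fX card_gt_0_iff[of X] by auto
    then have "(\<Sum>b\<in>X. opt_val (\<mu> b)) \<le> (\<Sum>b\<in>insert b' (X - {b}). opt_val (\<mu> b))"
      using b b' B(1) cX E(2) by (intro min) auto
    also have "\<dots> = opt_val (\<mu> b') + (\<Sum>b\<in>X. opt_val (\<mu> b)) - opt_val (\<mu> b)"
      using b b' fX by (simp add: sum_diff1)
    finally have "opt_val (\<mu> b) \<le> opt_val (\<mu> b')" by simp
    then have "\<mu> b' \<le> \<mu> b"
      using opt_val_strict_antimono[OF mu(1)[OF bB(1)], of "\<mu> b'"] by linarith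
    then have "h (\<mu> b') \<le> h (\<mu> b)" by (rule h_mono[OF mu(1)[OF bB(2)]])
    then show ?thesis by (simp add: mu bB)
  qed
  \<comment> \<open>With fewer than \<open>r\<close> terms in use, adding \<open>b'\<close> is
    allowed and would strictly lower the value unless its eigenvalue is 0.\<close>
  have zero: "l b' = 0" if b': "b' \<in> B - X" and "card X < r" for b'
  proof -
    have "(\<Sum>b\<in>X. opt_val (\<mu> b)) \<le> (\<Sum>b\<in>insert b' X. opt_val (\<mu> b))"
      using that B(1) fX by (intro min) auto
    then have "0 \<le> opt_val (\<mu> b')" using b' fX by simp
    then have "\<mu> b' = 0"
      using opt_val_strict_antimono[of 0 "\<mu> b'"] mu(1)[of b'] b' by fastforce
    then show ?thesis using mu(2)[of b'] b' by simp
  qed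
  obtain \<beta> :: "'k \<Rightarrow> real^('k::_)" where \<beta>: "bij_betw \<beta> UNIV B" "\<And>i j. i \<le> j \<Longrightarrow> l (\<beta> j) \<le> l (\<beta> i)"
      "\<And>i. \<beta> i \<in> X \<longleftrightarrow> pos i < card X"
    using sorted_enumeration[OF fB B(4,1), of l] swap by blast
  have inj: "inj \<beta>" and range: "range \<beta> = B" using \<beta>(1) by (auto simp: bij_betw_def)
  have N: "dyadic_sum UNIV (\<lambda>j. h (m j)) u v = dyadic_sum UNIV (\<lambda>j. l (\<beta> j)) (\<lambda>j. synth u (\<beta> j)) (\<lambda>j. synth v (\<beta> j))"
  proof (rule dyadic_sum_eqI)
    fix z
    define c where "c = (\<chi> j. v j \<bullet> z)"
    have bc: "b \<bullet> c = synth v b \<bullet> z" for b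
      unfolding synth_def inner_sum_left inner_scaleR_left c_def
      by (simp add: inner_vec_def[of b "\<chi> j. v j \<bullet> z"])
    have "dyadic_sum UNIV (\<lambda>j. h (m j)) u v *v z = synth u (H *v c)"
      by (simp add: dyadic_sum_mult synth_def H c_def)
    also have "c = (\<Sum>b\<in>B. (b \<bullet> c) *\<^sub>R b)"
      using orthonormal_basis_expansion[OF B(2)] B(4) by simp
    also have "H *v \<dots> = (\<Sum>b\<in>B. (b \<bullet> c) *\<^sub>R (l b *\<^sub>R b))"
      unfolding linear_sum[OF matrix_vector_mul_linear] matrix_vector_mult_scaleR l_def
      by (intro sum.cong refl arg_cong[of _ _ "\<lambda>z. _ *\<^sub>R z"] B(3))
    also have "synth u \<dots> = (\<Sum>b\<in>B. (l b * (synth v b \<bullet> z)) *\<^sub>R synth u b)"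
      by (simp add: linear_sum[OF linear_synth] linear_scale[OF linear_synth] bc mult.commute)
    also have "\<dots> = (\<Sum>j\<in>UNIV. (l (\<beta> j) * (synth v (\<beta> j) \<bullet> z)) *\<^sub>R synth u (\<beta> j))"
      unfolding range[symmetric] sum.reindex[OF inj] by simp
    finally show "dyadic_sum UNIV (\<lambda>j. h (m j)) u v *v z = \<dots>" .
  qed
  have T: "dyadic_sum E s x y = dyadic_sum {j. pos j < r} (\<lambda>j. l (\<beta> j)) (\<lambda>j. synth u (\<beta> j)) (\<lambda>j. synth v (\<beta> j))"
  proof (rule dyadic_sum_eqI)
    fix z
    let ?F = "\<lambda>b. (l b * (synth v b \<bullet> z)) *\<^sub>R synth u b"
    have XB: "X = \<beta> ` {j. pos j < card X}"
      using \<beta>(3) range B(1) by auto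
    have "dyadic_sum E s x y *v z = (\<Sum>b\<in>X. ?F b)"
      unfolding dyadic_sum_mult X_def sum.reindex[OF winj]
      by (rule sum.cong) (simp_all add: lw xw yw)
    also have "\<dots> = (\<Sum>j | pos j < card X. ?F (\<beta> j))"
      by (subst XB, subst sum.reindex) (use inj in \<open>auto simp: inj_on_def inj_def\<close>)
    \<comment> \<open>Positions from \<open>card X\<close> up to \<open>r\<close> carry the
      eigenvalue 0.\<close>
    also have "\<dots> = (\<Sum>j | pos j < r. ?F (\<beta> j))"
    proof (rule sum.mono_neutral_left)
      show "{j::'k. pos j < card X} \<subseteq> {j::'k. pos j < r}" using cX E(2) by auto
      show "\<forall>i\<in>{j::'k. pos j < r} - {j::'k. pos j < card X}. ?F (\<beta> i) = 0"
      proof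
        fix i assume "i \<in> {j::'k. pos j < r} - {j::'k. pos j < card X}"
        then have "\<beta> i \<in> B - X" "card X < r" using \<beta>(3)[of i] range by auto
        then show "?F (\<beta> i) = 0" by (simp add: zero)
      qed
    qed simp
    finally show "dyadic_sum E s x y *v z = \<dots>" .
  qed
  have "orthonormal_on UNIV (\<lambda>j. synth u (\<beta> j))" "orthonormal_on UNIV (\<lambda>j. synth v (\<beta> j))"
    using orthonormal_on_reindex[OF orthonormal_on_synth[OF u B(2)] inj]
      orthonormal_on_reindex[OF orthonormal_on_synth[OF v B(2)] inj] range by auto
  moreover have "0 \<le> l (\<beta> j)" for j using l01[of "\<beta> j"] range by auto
  ultimately show ?thesis
    unfolding is_rank_truncation_iff using card \<beta>(2) N T
    by (intro conjI exI[of _ "\<lambda>j. l (\<beta> j)"] exI[of _ "\<lambda>j. synth u (\<beta> j)"] exI[of _ "\<lambda>j. synth v (\<beta> j)"]) auto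
qed

section \<open>The loss under a rank constraint\<close>

lemma rank_whitening:
  shows "rank (mat_inv_sqrt (block_uu C) ** B ** mat_inv_sqrt (block_vv C)) \<le> rank B"
    "rank (mat_sqrt (block_uu C) ** A ** mat_sqrt (block_vv C)) \<le> rank A"
  by (meson order_trans rank_mul_le_left rank_mul_le_right)+

lemma unwhiten:
  fixes A :: "real^'v^'u"
  assumes C: "pos_def C"
  shows "mat_inv_sqrt (block_uu C) ** (mat_sqrt (block_uu C) ** A ** mat_sqrt (block_vv C)) ** mat_inv_sqrt (block_vv C) = A"
proof -
  have "mat_inv_sqrt (block_uu C) ** (mat_sqrt (block_uu C) ** A ** mat_sqrt (block_vv C)) ** mat_inv_sqrt (block_vv C)
      = (mat_inv_sqrt (block_uu C) ** mat_sqrt (block_uu C)) ** A ** (mat_sqrt (block_vv C) ** mat_inv_sqrt (block_vv C))"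
    by (simp only: matrix_mul_assoc)
  then show ?thesis
    by (simp add: mat_inv_sqrt[OF pos_def_block_uu[OF C]] mat_inv_sqrt[OF pos_def_block_vv[OF C]])
qed

text \<open>The lower bound for dyadic sums, applied to a decomposition of the whitened
  \<open>A\<close>. If one of its singular values is at least 1, the loss is infinite.\<close>

lemma L_joint_lower_bound:
  fixes C :: "real^('u::finite + 'v::finite)^('u + 'v)" and m :: "'k::{finite,linorder} \<Rightarrow> real"
  assumes C: "pos_def C" and u: "orthonormal_on UNIV u" and v: "orthonormal_on UNIV v"
    and m: "\<And>j. 0 \<le> m j" "\<And>i j. i \<le> j \<Longrightarrow> m j \<le> m i" and M: "whitened C = dyadic_sum UNIV m u v"
    and r: "0 < r" "r \<le> CARD('k)" and A: "rank A \<le> r"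
  shows "ereal (\<Sum>j | pos j < r. opt_val (m j)) \<le> L_joint (joint_gaussian C) A"
proof -
  obtain E s x where E: "finite E" "card E \<le> rank (mat_sqrt (block_uu C) ** A ** mat_sqrt (block_vv C))"
    "orthonormal_on E x" "orthonormal_on E (\<lambda>e. e)" "\<And>e. e \<in> E \<Longrightarrow> 0 < s e"
    "mat_sqrt (block_uu C) ** A ** mat_sqrt (block_vv C) = dyadic_sum E s x (\<lambda>e. e)"
    using ex_svd[of "mat_sqrt (block_uu C) ** A ** mat_sqrt (block_vv C)"] by metis
  have cE: "card E \<le> r" using E(2) rank_whitening(2)[of C A] A by linarith
  have L: "L_joint (joint_gaussian C) A
      = (if \<forall>i\<in>E. s i < 1 then ereal (\<Sum>i\<in>E. phi (s i) - s i * (x i \<bullet> (whitened C *v i))) else \<infinity>)"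
    using L_joint_dyadic_sum[OF C E(1,3,4), of s] E(5) by (simp add: unwhiten[OF C] less_imp_le flip: E(6))
  show ?thesis
    using loss_lower_bound[OF u v m E(1) cE r E(3,4,5)] by (simp add: L M)
qed

text \<open>With the singular vectors of the whitened matrix and the values \<open>h (m j)\<close>,
  each term attains its scalar minimum.\<close>

lemma L_joint_truncation:
  fixes C :: "real^('u::finite + 'v::finite)^('u + 'v)" and m :: "'k::{finite,linorder} \<Rightarrow> real"
  assumes C: "pos_def C" and u: "orthonormal_on UNIV u" and v: "orthonormal_on UNIV v"
    and m: "\<And>j. 0 \<le> m j" and M: "whitened C = dyadic_sum UNIV m u v"
  shows "L_joint (joint_gaussian C) (mat_inv_sqrt (block_uu C)
      ** dyadic_sum {j. pos j < r} (\<lambda>j. h (m j)) u v ** mat_inv_sqrt (block_vv C))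
    = ereal (\<Sum>j | pos j < r. opt_val (m j))"
proof -
  have "u j \<bullet> (whitened C *v v j) = m j" for j
    using u by (simp add: M dyadic_sum_mult_basis[OF v] orthonormal_onD)
  then show ?thesis
    by (subst L_joint_dyadic_sum[OF C])
       (auto intro!: sum.cong orthonormal_on_subset[OF u] orthonormal_on_subset[OF v]
         simp: h_root[OF m] opt_val_def)
qed

text \<open>A truncation may come from a decomposition other than \<open>u\<close>,
  \<open>v\<close>; \<open>svd_transfer\<close> makes it one of the whitened matrix, for which the
  bound is attained. Conversely, a minimizer attains the bound, and the equality case supplies the
  coordinates needed for \<open>rank_truncation_of_eigenvectors\<close>.\<close>

lemma rank_constrained_minimizers:
  fixes C :: "real^('u::finite + 'v::finite)^('u + 'v)" and m :: "'k::{finite,linorder} \<Rightarrow> real"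
  assumes C: "pos_def C" and card: "CARD('k) = min CARD('u) CARD('v)"
    and u: "orthonormal_on UNIV u" and v: "orthonormal_on UNIV v"
    and m: "\<And>j. 0 \<le> m j" "\<And>i j. i \<le> j \<Longrightarrow> m j \<le> m i" and M: "whitened C = dyadic_sum UNIV m u v"
    and r: "0 < r" "r \<le> CARD('k)"
  shows "is_arg_min (L_joint (joint_gaussian C)) (\<lambda>A. rank A \<le> r) A \<longleftrightarrow>
    (\<exists>T. is_rank_truncation TYPE('k) r (dyadic_sum UNIV (\<lambda>j. h (m j)) u v) T \<and>
      A = mat_inv_sqrt (block_uu C) ** T ** mat_inv_sqrt (block_vv C))"
    (is "?L \<longleftrightarrow> ?R")
proof
  assume ?R
  then obtain t :: "'k \<Rightarrow> real" and u' v' where t: "orthonormal_on UNIV u'" "orthonormal_on UNIV v'"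
      "\<And>j. 0 \<le> t j" "\<And>i j. i \<le> j \<Longrightarrow> t j \<le> t i"
      "dyadic_sum UNIV (\<lambda>j. h (m j)) u v = dyadic_sum UNIV t u' v'"
    and A: "A = mat_inv_sqrt (block_uu C) ** dyadic_sum {j. pos j < r} t u' v' ** mat_inv_sqrt (block_vv C)"
    unfolding is_rank_truncation_iff by blast
  \<comment> \<open>The singular values that \<open>h\<close> maps to \<open>t\<close>.\<close>
  define m' where "m' j = t j / (1 - (t j)\<^sup>2)" for j
  have t1: "t j < 1" for j
    by (rule svd_transfer(1)[OF u v t(1,2) m(1) t(3,5)])
  have M': "whitened C = dyadic_sum UNIV m' u' v'"
    unfolding M m'_def by (rule svd_transfer(2)[OF u v t(1,2) m(1) t(3,5)])
  have sq: "0 < 1 - (t j)\<^sup>2" for j by (rule one_minus_square_pos[OF t(3) t1])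
  have m': "0 \<le> m' j" for j using t(3)[of j] sq[of j] by (simp add: m'_def)
  have m'': "m' j \<le> m' i" if "i \<le> j" for i j
    unfolding m'_def
    by (rule frac_le) (use t(3) t(4)[OF that] sq in \<open>auto intro: power_mono\<close>)
  have hm: "h (m' j) = t j" for j
    unfolding m'_def by (rule h_inverse[OF t(3) t1])
  have "rank A \<le> rank (dyadic_sum {j. pos j < r} t u' v')"
    unfolding A by (rule rank_whitening)
  also have "\<dots> \<le> card {j::'k. pos j < r}" by (rule rank_dyadic_sum) simp
  finally have "rank A \<le> r" by (simp add: card_pos_less[OF r(2)])
  moreover have "L_joint (joint_gaussian C) A = ereal (\<Sum>j | pos j < r. opt_val (m' j))"
    using L_joint_truncation[OF C t(1,2) m' M', of r] by (simp add: A hm)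
  ultimately show ?L
    using L_joint_lower_bound[OF C t(1,2) m' m'' M' r] by (auto simp: is_arg_min_def not_less)
next
  assume min: ?L
  define B where "B = mat_sqrt (block_uu C) ** A ** mat_sqrt (block_vv C)"
  obtain E s x where E: "finite E" "card E \<le> rank B" "orthonormal_on E x" "orthonormal_on E (\<lambda>e. e)"
    "\<And>e. e \<in> E \<Longrightarrow> 0 < s e" "B = dyadic_sum E s x (\<lambda>e. e)"
    using ex_svd[of B] by metis
  have A: "A = mat_inv_sqrt (block_uu C) ** dyadic_sum E s x (\<lambda>e. e) ** mat_inv_sqrt (block_vv C)"
    unfolding E(6)[symmetric] B_def by (rule unwhiten[OF C, symmetric])
  have cE: "card E \<le> r"
    using E(2) rank_whitening(2)[of C A] min by (simp add: is_arg_min_def B_def)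
  have L: "L_joint (joint_gaussian C) A
      = (if \<forall>i\<in>E. s i < 1 then ereal (\<Sum>i\<in>E. phi (s i) - s i * (x i \<bullet> (dyadic_sum UNIV m u v *v i))) else \<infinity>)"
    unfolding A M[symmetric] by (rule L_joint_dyadic_sum[OF C E(1,3,4)]) (simp add: E(5) less_imp_le)
  have le: "L_joint (joint_gaussian C) A \<le> L_joint (joint_gaussian C)
      (mat_inv_sqrt (block_uu C) ** dyadic_sum J l a b ** mat_inv_sqrt (block_vv C))"
    if "finite J" "card J \<le> r" for J :: "'i set" and l a b
  proof -
    have "rank (mat_inv_sqrt (block_uu C) ** dyadic_sum J l a b ** mat_inv_sqrt (block_vv C)) \<le> r"
      using rank_whitening(1)[of C "dyadic_sum J l a b"] rank_dyadic_sum[OF that(1), of l a b] that(2)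
      by linarith
    then show ?thesis using min by (auto simp: is_arg_min_def not_less)
  qed
  have opt: "L_joint (joint_gaussian C) A \<le> ereal (\<Sum>j | pos j < r. opt_val (m j))"
    using le[of "{j::'k. pos j < r}" "\<lambda>j. h (m j)" u v] L_joint_truncation[OF C u v m(1) M, of r]
    by (simp add: card_pos_less[OF r(2)])
  \<comment> \<open>Comparison with the truncation shows that the loss of \<open>A\<close> is
    finite.\<close>
  have s1: "s i < 1" if "i \<in> E" for i
    using opt that by (auto simp: L split: if_splits)
  then have L': "L_joint (joint_gaussian C) A
      = ereal (\<Sum>i\<in>E. phi (s i) - s i * (x i \<bullet> (dyadic_sum UNIV m u v *v i)))"
    by (simp add: L)
  have eq: "(\<Sum>i\<in>E. phi (s i) - s i * (x i \<bullet> (dyadic_sum UNIV m u v *v i))) = (\<Sum>j | pos j < r. opt_val (m j))"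
  proof (rule antisym)
    show "(\<Sum>j | pos j < r. opt_val (m j)) \<le> (\<Sum>i\<in>E. phi (s i) - s i * (x i \<bullet> (dyadic_sum UNIV m u v *v i)))"
      by (rule loss_lower_bound[OF u v m E(1) cE r E(3,4,5) s1])
  qed (use opt L' in simp)
  note coord = loss_lower_bound_eq[OF u v m E(1) cE r E(3,4,5) s1 eq]
  have "is_rank_truncation TYPE('k) r (dyadic_sum UNIV (\<lambda>j. h (m j)) u v) (dyadic_sum E s x (\<lambda>e. e))"
  proof (rule rank_truncation_of_eigenvectors[OF card u v m(1) E(3,1) cE])
    fix J :: "(real^('k::_)) set" and l :: "real^('k::_) \<Rightarrow> real"
      and a :: "real^('k::_) \<Rightarrow> real^'u" and b :: "real^('k::_) \<Rightarrow> real^'v"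
    assume J: "finite J" "card J \<le> r" "orthonormal_on J a" "orthonormal_on J b" "\<And>i. i \<in> J \<Longrightarrow> 0 \<le> l i \<and> l i < 1"
    have "L_joint (joint_gaussian C) (mat_inv_sqrt (block_uu C) ** dyadic_sum J l a b ** mat_inv_sqrt (block_vv C))
        = ereal (\<Sum>i\<in>J. phi (l i) - l i * (a i \<bullet> (dyadic_sum UNIV m u v *v b i)))"
      using L_joint_dyadic_sum[OF C J(1,3,4), of l] J(5) by (simp add: M)
    then show "(\<Sum>i\<in>E. phi (s i) - s i * (x i \<bullet> (dyadic_sum UNIV m u v *v i)))
        \<le> (\<Sum>i\<in>J. phi (l i) - l i * (a i \<bullet> (dyadic_sum UNIV m u v *v b i)))"
      using le[OF J(1,2), of l a b] by (simp add: L')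
  qed (use coord in blast)+
  then show ?R using A by blast
qed

theorem theorem5p6:
  fixes C :: "real^('u::finite + 'v::finite)^('u + 'v)"
    and \<mu> :: "((real^'u) \<times> (real^'v)) measure"
    and U :: "real^('k::{finite,linorder})^'u"
    and S :: "real^('k::{finite,linorder})^('k::{finite,linorder})"
    and V :: "real^('k::{finite,linorder})^'v"
  assumes "pos_def C"
    and "\<mu> = joint_gaussian C"
    and "is_svd (mat_inv_sqrt (block_uu C) ** block_uv C ** mat_inv_sqrt (block_vv C)) U S V"
  shows "(\<forall>A. is_arg_min (L_joint \<mu>) (\<lambda>_. True) A \<longleftrightarrow>
            A = mat_inv_sqrt (block_uu C) ** (U ** diag_map h S ** transpose V)
                  ** mat_inv_sqrt (block_vv C)) \<and>
         (\<forall>r. 0 < r \<and> r \<le> min CARD('u) CARD('v) \<longrightarrow>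
            (\<forall>A. is_arg_min (L_joint \<mu>) (\<lambda>A. rank A \<le> r) A \<longleftrightarrow>
              (\<exists>T. is_rank_truncation TYPE('k) r (U ** diag_map h S ** transpose V) T \<and>
                   A = mat_inv_sqrt (block_uu C) ** T ** mat_inv_sqrt (block_vv C))))"
proof -
  define N where "N = U ** diag_map h S ** transpose V"
  define u where "u j = column j U" for j
  define v where "v j = column j V" for j
  define m where "m j = S $ j $ j" for j
  have card: "CARD('k) = min CARD('u) CARD('v)"
    and u: "orthonormal_on UNIV u" and v: "orthonormal_on UNIV v"
    and m: "\<And>j. 0 \<le> m j" "\<And>i j. i \<le> j \<Longrightarrow> m j \<le> m i" and M: "whitened C = dyadic_sum UNIV m u v"
    using assms(3) unfolding is_svd_iff whitened_def u_def[abs_def] v_def[abs_def] m_def[abs_def] by auto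
  have N: "N = dyadic_sum UNIV (\<lambda>j. h (m j)) u v"
    unfolding N_def u_def v_def m_def
    by (subst diagonal_sandwich) (simp_all add: diag_map_def)
  note minimizers = rank_constrained_minimizers[OF assms(1) card u v m M, folded N assms(2)]
  \<comment> \<open>The unconstrained problem is the case \<open>r = CARD('k)\<close>, whose rank
    bound holds for every matrix.\<close>
  have "is_arg_min (L_joint \<mu>) (\<lambda>_. True) A \<longleftrightarrow>
      A = mat_inv_sqrt (block_uu C) ** N ** mat_inv_sqrt (block_vv C)" for A
  proof -
    have "is_rank_truncation TYPE('k) CARD('k) N T \<longleftrightarrow> T = N" for T
    proof -
      \<comment> \<open>Every position counts, so the truncation is all of \<open>N\<close>
        whichever decomposition is chosen; this gives uniqueness.\<close>
      have all: "{j::'k. pos j < CARD('k)} = UNIV" using pos_less by blast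
      have "is_rank_truncation TYPE('k) CARD('k) N N"
        unfolding is_rank_truncation_iff all using card u v N h_root(1)[OF m(1)] h_mono[OF m(1) m(2)]
        by (intro conjI exI[of _ "\<lambda>j. h (m j)"] exI[of _ u] exI[of _ v]) simp_all
      moreover have "T = N" if "is_rank_truncation TYPE('k) CARD('k) N T"
        using that unfolding is_rank_truncation_iff all by blast
      ultimately show ?thesis by blast
    qed
    moreover have "rank X \<le> CARD('k)" for X :: "real^'v^'u"
      using rank_bound[of X] card by (simp add: min.commute)
    ultimately show ?thesis
      using minimizers[of "CARD('k)" A] by (simp add: is_arg_min_def)
  qed
  then show ?thesis
    using minimizers card unfolding N_def[symmetric] by auto
qed

end
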